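(* The operator $\mathcal{H}_{d,\Lambda}$ is a minimal annihilator for $V_{d,\Lambda}$.
   Context: Sequences and operators. $\ell^{m}(\mathbb{Z})$ and $\ell^{m\times m}(\mathbb{Z})$ denote the spaces of all sequences indexed by $\mathbb{Z}$ of $m$-vectors and of $m\times m$ matrices; the subscript $00$ means finitely supported. Masks are real matrix valued; vector sequences may be complex valued (when imaginary frequencies occur). The symbol of $A\in\ell_{00}^{m\times m}(\mathbb{Z})$ is $A^*(z)=\sum_{\alpha\in\mathbb{Z}}A(\alpha)z^\alpha$. The subdivision operator with mask $A$ is $\mathcal{S}_A c(\alpha)=\sum_{\beta}A(\alpha-2\beta)c(\beta)$. Convolution is $(A*B)(\alpha)=\sum_{\beta}A(\beta)B(\alpha-\beta)$, likewise for $A*c$ with $c\in\ell^m(\mathbb{Z})$. A convolution operator $\mathcal{H}$ with impulse response $H$ acts by $\mathcal{H}c=H*c$. Function space. Let $p\ge 0$, $r\ge 1$ be integers, $d=p+2r$, and $\Lambda=\{\lambda_1,\dots,\lambda_r\}\subset\mathbb{R}\cup i\mathbb{R}$ with all $\lambda_j\neq0$ and $\lambda_i\neq\pm\lambda_j$ for $i\ne j$. Put $V_{d,\Lambda}=\mathrm{span}\{1,x,\dots,x^p,e^{\pm\lambda_1x},\dots,e^{\pm\lambda_rx}\}$. For a $d$ times continuously differentiable $f$, $v_f\in\ell^{d+1}(\mathbb{Z})$ is $v_f(\alpha)=[f(\alpha),f'(\alpha),\dots,f^{(d)}(\alpha)]^T$. Minimal annihilator. A convolution operator $\mathcal{H}:\ell^{d+1}(\mathbb{Z})\to\ell^{d+1}(\mathbb{Z})$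 with impulse response $H$ that annihilates $V$ (that is, $\mathcal{H}v_f=0$ for all $f\in V$) is called a minimal annihilator for $V$ if it has both of the following properties. (1) With respect to subdivision: for any $C\in\ell_{00}^{(d+1)\times(d+1)}(\mathbb{Z})$ with $\mathcal{S}_Cv_f=0$ for all $f\in V$ there exists $B\in\ell_{00}^{(d+1)\times(d+1)}(\mathbb{Z})$ with $\mathcal{S}_C=\mathcal{S}_B\mathcal{H}$. (2) With respect to convolution: for any $C\in\ell_{00}^{(d+1)\times(d+1)}(\mathbb{Z})$ with $C*v_f=0$ for all $f\in V$ there exists $B\in\ell_{00}^{(d+1)\times(d+1)}(\mathbb{Z})$ with $C=B*H$. The operator $\mathcal{H}_{d,\Lambda}$ is the convolution operator on $\ell^{d+1}(\mathbb{Z})$ with symbol (rows and columns indexed $0,\dots,d$) $$H_{d,\Lambda}^*(z)=\begin{bmatrix}T_p^*(z)&Q\\0&R^*(z)\end{bmatrix}.$$ Here $T_p^*(z)$ is the $(p+1)\times(p+1)$ upper triangular matrix with diagonal entries $z^{-1}-1$ and entries $-\frac{1}{(k'-k)!}$ at position $(k,k')$, $k<k'$. The matrix $R^*(z)=L_{d,\Lambda}\Delta_\Lambda^*(z)L_{d,\Lambda}^{-1}$ is $2r\times2r$, where $\Delta^*_\Lambda(z)=\mathrm{diag}(z^{-1}-e^{\lambda_1},z^{-1}-e^{-\lambda_1},\dots,z^{-1}-e^{\lambda_r},z^{-1}-e^{-\lambda_r})$ and $L_{d,\Lambda}$ is the (nonsingular) $2r\times 2r$ matrix whose columns are $[\mu^{p+1},\mu^{p+2},\dots,\mu^{d}]^T$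 for $\mu=\lambda_1,-\lambda_1,\dots,\lambda_r,-\lambda_r$. Finally $Q=[h_{k,m}]_{k=0,\dots,p;\,m=p+1,\dots,d}$ is the constant (independent of $z$) matrix uniquely determined by $$\mu^ke^{\mu}-\sum_{i=0}^{p-k}\frac{\mu^{k+i}}{i!}+\sum_{m=p+1}^{d}\mu^m h_{k,m}=0,\qquad k=0,\dots,p,\ \mu\in\{\pm\lambda_1,\dots,\pm\lambda_r\}.$$ Equivalently, $H^*_{d,\Lambda}(e^{-\mu})[1,\mu,\dots,\mu^d]^T=0$ for all these $\mu$. *)

theory Defs
  imports
    "HOL-Analysis.Derivative"
    "HOL-Library.Function_Algebras"
    "HOL-Library.Groups_Big_Fun"
    "Jordan_Normal_Form.Gauss_Jordan_Elimination"
begin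

unbundle no vec_syntax
hide_type (open) Finite_Cartesian_Product.vec
hide_const (open) Finite_Cartesian_Product.vec

section \<open>Masks, symbols and operators\<close>

text \<open>
  A mask is real; it acts on complex vector sequences through the entrywise embedding of
  the reals. \<^term>\<open>Sum_any\<close> is the sum over the support of the summand, which is finite
  wherever it is used here, because masks are finitely supported.
\<close>

definition masks :: "nat \<Rightarrow> (int \<Rightarrow> real mat) set" where
  "masks m = {A. (\<forall>\<alpha>. A \<alpha> \<in> carrier_mat m m) \<and> finite {\<alpha>. A \<alpha> \<noteq> 0\<^sub>m m m}}"

definition vseqs :: "nat \<Rightarrow> (int \<Rightarrow> complex vec) set" where
  "vseqs m = {c. \<forall>\<alpha>. c \<alpha> \<in> carrier_vec m}"

definition symbol :: "nat \<Rightarrow> (int \<Rightarrow> real mat) \<Rightarrow> complex \<Rightarrow> complex mat" where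
  "symbol m A z = mat m m (\<lambda>ij. Sum_any (\<lambda>\<alpha>. complex_of_real (A \<alpha> $$ ij) * z powi \<alpha>))"

definition subdiv :: "nat \<Rightarrow> (int \<Rightarrow> real mat) \<Rightarrow> (int \<Rightarrow> complex vec) \<Rightarrow> int \<Rightarrow> complex vec" where
  "subdiv m A c = (\<lambda>\<alpha>. vec m (\<lambda>i.
     Sum_any (\<lambda>\<beta>. (map_mat complex_of_real (A (\<alpha> - 2 * \<beta>)) *\<^sub>v c \<beta>) $ i)))"

definition conv_mask :: "nat \<Rightarrow> (int \<Rightarrow> real mat) \<Rightarrow> (int \<Rightarrow> real mat) \<Rightarrow> int \<Rightarrow> real mat" where
  "conv_mask m A B = (\<lambda>\<alpha>. mat m m (\<lambda>ij. Sum_any (\<lambda>\<beta>. (A \<beta> * B (\<alpha> - \<beta>)) $$ ij)))"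

definition conv_vec :: "nat \<Rightarrow> (int \<Rightarrow> real mat) \<Rightarrow> (int \<Rightarrow> complex vec) \<Rightarrow> int \<Rightarrow> complex vec" where
  "conv_vec m A c = (\<lambda>\<alpha>. vec m (\<lambda>i.
     Sum_any (\<lambda>\<beta>. (map_mat complex_of_real (A \<beta>) *\<^sub>v c (\<alpha> - \<beta>)) $ i)))"


section \<open>The function space\<close>

interpretation cfun: vector_space "\<lambda>(a::complex) (f::real \<Rightarrow> complex) x. a * f x"
  by standard (simp_all add: plus_fun_def algebra_simps)

definition V_space :: "nat \<Rightarrow> nat \<Rightarrow> (nat \<Rightarrow> complex) \<Rightarrow> (real \<Rightarrow> complex) set" where
  "V_space p r lam = cfun.span
     ({\<lambda>x. complex_of_real x ^ k | k. k \<le> p} \<union>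
      {\<lambda>x. exp (\<mu> * complex_of_real x) | \<mu> j. j < r \<and> \<mu> \<in> {lam j, - lam j}})"

definition nth_deriv :: "nat \<Rightarrow> (real \<Rightarrow> complex) \<Rightarrow> real \<Rightarrow> complex" where
  "nth_deriv k = (\<lambda>f x. vector_derivative f (at x)) ^^ k"

definition v_seq :: "nat \<Rightarrow> (real \<Rightarrow> complex) \<Rightarrow> int \<Rightarrow> complex vec" where
  "v_seq d f = (\<lambda>\<alpha>. vec (d + 1) (\<lambda>k. nth_deriv k f (real_of_int \<alpha>)))"


section \<open>Minimal annihilators\<close>

definition minimal_annihilator :: "nat \<Rightarrow> (real \<Rightarrow> complex) set \<Rightarrow> (int \<Rightarrow> real mat) \<Rightarrow> bool" where
  "minimal_annihilator d V H \<longleftrightarrow>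
     H \<in> masks (d + 1) \<and>
     (\<forall>f\<in>V. conv_vec (d + 1) H (v_seq d f) = (\<lambda>_. 0\<^sub>v (d + 1))) \<and>
     (\<forall>C\<in>masks (d + 1).
        (\<forall>f\<in>V. subdiv (d + 1) C (v_seq d f) = (\<lambda>_. 0\<^sub>v (d + 1))) \<longrightarrow>
        (\<exists>B\<in>masks (d + 1). \<forall>c\<in>vseqs (d + 1).
           subdiv (d + 1) C c = subdiv (d + 1) B (conv_vec (d + 1) H c))) \<and>
     (\<forall>C\<in>masks (d + 1).
        (\<forall>f\<in>V. conv_vec (d + 1) C (v_seq d f) = (\<lambda>_. 0\<^sub>v (d + 1))) \<longrightarrow>
        (\<exists>B\<in>masks (d + 1). C = conv_mask (d + 1) B H))"


section \<open>The annihilator of the exponential-polynomial space\<close>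

text \<open>The frequencies are \<^term>\<open>lam 0\<close>, ..., \<^term>\<open>lam (r - 1)\<close>; \<open>mu lam\<close> enumerates
  them with both signs, in the order of the columns of \<open>L_mat\<close>.\<close>

definition mu :: "(nat \<Rightarrow> complex) \<Rightarrow> nat \<Rightarrow> complex" where
  "mu lam c = (if even c then lam (c div 2) else - lam (c div 2))"

definition T_symbol :: "nat \<Rightarrow> complex \<Rightarrow> complex mat" where
  "T_symbol p z = mat (p + 1) (p + 1) (\<lambda>(k, k').
     if k = k' then inverse z - 1 else if k < k' then - 1 / fact (k' - k) else 0)"

definition Delta_symbol :: "nat \<Rightarrow> (nat \<Rightarrow> complex) \<Rightarrow> complex \<Rightarrow> complex mat" where
  "Delta_symbol r lam z = mat_diag (2 * r) (\<lambda>c. inverse z - exp (mu lam c))"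

definition L_mat :: "nat \<Rightarrow> nat \<Rightarrow> (nat \<Rightarrow> complex) \<Rightarrow> complex mat" where
  "L_mat p r lam = mat (2 * r) (2 * r) (\<lambda>(i, c). mu lam c ^ (p + 1 + i))"

definition R_symbol :: "nat \<Rightarrow> nat \<Rightarrow> (nat \<Rightarrow> complex) \<Rightarrow> complex \<Rightarrow> complex mat" where
  "R_symbol p r lam z =
     L_mat p r lam * Delta_symbol r lam z * the (mat_inverse (L_mat p r lam))"

text \<open>Column \<open>m\<close> of the block \<open>Q\<close> (\<open>p + 1 \<le> m \<le> d\<close>) is stored at index \<open>m - (p + 1)\<close>.\<close>

definition Q_mat :: "nat \<Rightarrow> nat \<Rightarrow> (nat \<Rightarrow> complex) \<Rightarrow> complex mat" where
  "Q_mat p r lam = (THE Q. Q \<in> carrier_mat (p + 1) (2 * r) \<and>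
     (\<forall>k\<le>p. \<forall>j<r. \<forall>\<mu>\<in>{lam j, - lam j}.
        \<mu> ^ k * exp \<mu> - (\<Sum>i=0..p - k. \<mu> ^ (k + i) / fact i)
          + (\<Sum>m=p + 1..p + 2 * r. \<mu> ^ m * Q $$ (k, m - (p + 1))) = 0))"

definition H_symbol :: "nat \<Rightarrow> nat \<Rightarrow> (nat \<Rightarrow> complex) \<Rightarrow> complex \<Rightarrow> complex mat" where
  "H_symbol p r lam z = four_block_mat
     (T_symbol p z)              (Q_mat p r lam)
     (0\<^sub>m (2 * r) (p + 1))  (R_symbol p r lam z)"

text \<open>The impulse response is the mask with symbol \<^const>\<open>H_symbol\<close>. It is real although the
  frequencies may be imaginary: the set of all \<open>\<plusminus>\<lambda>\<^sub>j\<close> is then closed under conjugation.\<close>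

definition H_mask :: "nat \<Rightarrow> nat \<Rightarrow> (nat \<Rightarrow> complex) \<Rightarrow> int \<Rightarrow> real mat" where
  "H_mask p r lam = (THE H. H \<in> masks (p + 2 * r + 1) \<and>
     (\<forall>z. z \<noteq> 0 \<longrightarrow> symbol (p + 2 * r + 1) H z = H_symbol p r lam z))"

end

theory Submission
  imports Defs "Jordan_Normal_Form.Determinant"
begin

text \<open>
  The symbol of the annihilator is affine in \<open>z\<^sup>-\<^sup>1\<close>: it equals \<open>z\<^sup>-\<^sup>1 I - E\<close> for a constant
  matrix \<open>E\<close>. Hence the operator is \<open>c(\<alpha>) \<mapsto> c(\<alpha> + 1) - E c(\<alpha>)\<close>, and the theorem rests on two
  facts about \<open>E\<close>: the vectors of derivatives satisfy \<open>v\<^sub>f(\<alpha> + 1) = E v\<^sub>f(\<alpha>)\<close> for every \<open>f\<close> in the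
  function space, and the initial values \<open>v\<^sub>f(0)\<close> span the whole space of \<open>(d + 1)\<close>-vectors.

  Minimality follows from these two facts alone (\<open>shift_mask_minimal_annihilator\<close>). Factoring
  \<open>C = B * H\<close> means solving \<open>B(\<alpha> + 1) = C(\<alpha>) + B(\<alpha>) E\<close>. Starting with zero to the left of the
  support of \<open>C\<close>, this recursion determines \<open>B\<close>; it is Euclidean division of the symbol of \<open>C\<close>,
  on the right, by the monic linear polynomial \<open>z\<^sup>-\<^sup>1 I - E\<close>. Once the support of \<open>C\<close> has been
  passed, \<open>B\<close> applied to \<open>v\<^sub>f(0)\<close> is a value of \<open>C * v\<^sub>f\<close>. So the remainder kills all \<open>v\<^sub>f(0)\<close>, it
  vanishes because they span, and \<open>B\<close> is finitely supported (\<open>right_division\<close>). A subdivision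
  operator acts on the even and on the odd entries of its output as a convolution with the even
  and the odd part of the mask; both parts are divided, and the quotients are interleaved.

  The facts about the concrete \<open>E\<close> come from one observation, \<open>vanishing_coeffs\<close>: the \<open>2r\<close>
  numbers \<open>\<plusminus>\<lambda>\<^sub>j\<close> are distinct and nonzero, so a polynomial \<open>x\<^sub>0 t\<^sup>p\<^sup>+\<^sup>1 + \<dots> + x\<^sub>2\<^sub>r\<^sub>-\<^sub>1 t\<^sup>d\<close> that vanishes at
  all of them is zero. This makes \<open>L\<close> invertible and \<open>Q\<close> well defined, it shows that \<open>E\<close> is real
  (its complex conjugate acts in the same way on all vectors of powers of the \<open>\<plusminus>\<lambda>\<^sub>j\<close>, which form
  a set closed under conjugation), and, together with the monomials, it gives the spanning
  property. The propagation property is Taylor expansion for the monomials and the defining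
  equations of \<open>Q\<close> and \<open>R\<close> for the exponentials.
\<close>

section \<open>Finitely supported masks\<close>

abbreviation cmat :: "real mat \<Rightarrow> complex mat" where
  "cmat \<equiv> map_mat complex_of_real"

lemma cmat_mult_vec_index:
  assumes "A \<in> carrier_mat n n" "v \<in> carrier_vec n" "i < n"
  shows "(cmat A *\<^sub>v v) $ i = (\<Sum>j<n. of_real (A $$ (i,j)) * v $ j)"
  using assms by (auto simp: mult_mat_vec_def scalar_prod_def atLeast0LessThan intro!: sum.cong)

lemma cmat_zero_mult_vec:
  assumes "v \<in> carrier_vec n"
  shows "cmat (0\<^sub>m n n) *\<^sub>v v = 0\<^sub>v n"
proof -
  have "cmat (0\<^sub>m n n) = 0\<^sub>m n n" by (intro eq_matI) auto
  then show ?thesis using assms by (simp, intro eq_vecI) auto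
qed

lemma cmat_mult_vec_dim [simp]: "A \<in> carrier_mat n n \<Longrightarrow> cmat A *\<^sub>v v \<in> carrier_vec n"
  by (rule carrier_vecI) simp

lemma mult_mat_index:
  assumes "A \<in> carrier_mat n n" "B \<in> carrier_mat n n" "i < n" "j < n"
  shows "(A * B) $$ (i,j) = (\<Sum>k<n. A $$ (i,k) * B $$ (k,j))"
  using assms by (auto simp: times_mat_def scalar_prod_def atLeast0LessThan intro!: sum.cong)

lemma cmat_mult:
  assumes "A \<in> carrier_mat n n" "B \<in> carrier_mat n n"
  shows "cmat (A * B) = cmat A * cmat B"
  using assms by (intro eq_matI) (auto simp: scalar_prod_def)

lemma masks_carrier: "A \<in> masks n \<Longrightarrow> A \<alpha> \<in> carrier_mat n n"
  by (simp add: masks_def)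

lemma masks_bounded:
  assumes "A \<in> masks n"
  obtains N :: nat where "\<And>\<alpha>. \<alpha> < - int N \<or> int N < \<alpha> \<Longrightarrow> A \<alpha> = 0\<^sub>m n n"
proof -
  let ?S = "(\<lambda>\<alpha>. nat \<bar>\<alpha>\<bar>) ` {\<alpha>. A \<alpha> \<noteq> 0\<^sub>m n n}"
  have fin: "finite ?S" using assms by (simp add: masks_def)
  have "A \<alpha> = 0\<^sub>m n n" if "\<alpha> < - int (Max ?S) \<or> int (Max ?S) < \<alpha>" for \<alpha>
  proof (rule ccontr)
    assume "A \<alpha> \<noteq> 0\<^sub>m n n"
    then have "nat \<bar>\<alpha>\<bar> \<le> Max ?S" using fin by (intro Max_ge) auto
    with that show False by linarith
  qed
  with that show thesis by blast
qed

lemma masks_if_bounded: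
  assumes "\<And>\<alpha>. A \<alpha> \<in> carrier_mat n n"
    and "\<And>\<alpha>. \<alpha> < a \<or> b < \<alpha> \<Longrightarrow> A \<alpha> = 0\<^sub>m n n"
  shows "A \<in> masks n"
proof -
  have "{\<alpha>. A \<alpha> \<noteq> 0\<^sub>m n n} \<subseteq> {a..b}" using assms(2) by (force simp: not_less[symmetric])
  then have "finite {\<alpha>. A \<alpha> \<noteq> 0\<^sub>m n n}" by (rule finite_subset) simp
  with assms(1) show ?thesis by (simp add: masks_def)
qed

lemma finite_vec_summand:
  assumes "A \<in> masks n" "inj g" "i < n" "\<And>\<beta>. c \<beta> \<in> carrier_vec n"
  shows "finite {\<beta>. (cmat (A (g \<beta>)) *\<^sub>v c \<beta>) $ i \<noteq> 0}"
proof (rule finite_subset)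
  show "{\<beta>. (cmat (A (g \<beta>)) *\<^sub>v c \<beta>) $ i \<noteq> 0} \<subseteq> g -` {\<alpha>. A \<alpha> \<noteq> 0\<^sub>m n n}"
    using assms(3,4) by (auto simp: cmat_zero_mult_vec simp del: index_mult_mat_vec)
  show "finite (g -` {\<alpha>. A \<alpha> \<noteq> 0\<^sub>m n n})"
    using assms(1,2) by (intro finite_vimageI) (auto simp: masks_def)
qed

section \<open>First-order difference operators\<close>

text \<open>
  The impulse response of \<open>c(\<alpha>) \<mapsto> c(\<alpha> + 1) - E c(\<alpha>)\<close>. The shift sits at \<open>-1\<close> because the
  convolution evaluates \<open>c\<close> at \<open>\<alpha> - \<beta>\<close>.
\<close>

definition shift_mask :: "nat \<Rightarrow> real mat \<Rightarrow> int \<Rightarrow> real mat" where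
  "shift_mask n E \<alpha> = (if \<alpha> = -1 then 1\<^sub>m n else if \<alpha> = 0 then - E else 0\<^sub>m n n)"

lemma shift_mask_in_masks:
  assumes "E \<in> carrier_mat n n"
  shows "shift_mask n E \<in> masks n"
  by (rule masks_if_bounded[of _ _ "-1" 0]) (use assms in \<open>auto simp: shift_mask_def\<close>)

lemma conv_vec_shift_mask:
  assumes E: "E \<in> carrier_mat n n" and c: "\<And>\<beta>. c \<beta> \<in> carrier_vec n"
  shows "conv_vec n (shift_mask n E) c \<alpha> = c (\<alpha> + 1) - cmat E *\<^sub>v c \<alpha>"
proof (rule eq_vecI)
  show "dim_vec (conv_vec n (shift_mask n E) c \<alpha>) = dim_vec (c (\<alpha> + 1) - cmat E *\<^sub>v c \<alpha>)"
    using E by (simp add: conv_vec_def)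
next
  fix i assume "i < dim_vec (c (\<alpha> + 1) - cmat E *\<^sub>v c \<alpha>)"
  then have i: "i < n" using E by simp
  let ?g = "\<lambda>\<beta>. (cmat (shift_mask n E \<beta>) *\<^sub>v c (\<alpha> - \<beta>)) $ i"
  have z: "?g \<beta> = 0" if "\<beta> \<notin> {-1, 0}" for \<beta>
    using that i c by (auto simp: shift_mask_def cmat_zero_mult_vec simp del: index_mult_mat_vec)
  have "Sum_any ?g = sum ?g {-1, 0}"
    by (rule Sum_any.expand_superset) (use z in auto)
  also have "\<dots> = (c (\<alpha> + 1) - cmat E *\<^sub>v c \<alpha>) $ i"
  proof -
    have "(cmat (1\<^sub>m n) *\<^sub>v c (\<alpha> + 1)) $ i = c (\<alpha> + 1) $ i"
    proof -
      have "cmat (1\<^sub>m n) = 1\<^sub>m n" by (intro eq_matI) auto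
      then show ?thesis using c by simp
    qed
    moreover have "(cmat (- E) *\<^sub>v c \<alpha>) $ i = - (cmat E *\<^sub>v c \<alpha>) $ i"
      using i c E by (simp add: cmat_mult_vec_index[of _ n] sum_negf del: index_mult_mat_vec)
    ultimately show ?thesis using i c E by (simp add: shift_mask_def del: index_mult_mat_vec)
  qed
  finally show "conv_vec n (shift_mask n E) c \<alpha> $ i = (c (\<alpha> + 1) - cmat E *\<^sub>v c \<alpha>) $ i"
    using i by (simp add: conv_vec_def)
qed

lemma conv_mask_shift_mask:
  assumes E: "E \<in> carrier_mat n n" and B: "\<And>\<beta>. B \<beta> \<in> carrier_mat n n"
  shows "conv_mask n B (shift_mask n E) \<alpha> = B (\<alpha> + 1) - B \<alpha> * E"
proof (rule eq_matI)
  show "dim_row (conv_mask n B (shift_mask n E) \<alpha>) = dim_row (B (\<alpha> + 1) - B \<alpha> * E)"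
    "dim_col (conv_mask n B (shift_mask n E) \<alpha>) = dim_col (B (\<alpha> + 1) - B \<alpha> * E)"
    using E B[of \<alpha>] B[of "\<alpha>+1"] by (auto simp: conv_mask_def)
next
  fix i j assume "i < dim_row (B (\<alpha> + 1) - B \<alpha> * E)" "j < dim_col (B (\<alpha> + 1) - B \<alpha> * E)"
  then have i: "i < n" and j: "j < n" using E B[of \<alpha>] by auto
  let ?g = "\<lambda>\<beta>. (B \<beta> * shift_mask n E (\<alpha> - \<beta>)) $$ (i,j)"
  have z: "?g \<beta> = 0" if "\<beta> \<notin> {\<alpha> + 1, \<alpha>}" for \<beta>
    using that i j B E by (auto simp: shift_mask_def mult_mat_index[of _ n])
  have "Sum_any ?g = sum ?g {\<alpha> + 1, \<alpha>}"
    by (rule Sum_any.expand_superset) (use z in auto)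
  also have "\<dots> = (B (\<alpha> + 1) - B \<alpha> * E) $$ (i,j)"
  proof -
    have "(B \<alpha> * - E) $$ (i,j) = - (B \<alpha> * E) $$ (i,j)"
      using i j B E by (simp add: mult_mat_index[of _ n] sum_negf del: index_mult_mat)
    then show ?thesis using i j B[of \<alpha>] B[of "\<alpha>+1"] E
      by (simp add: shift_mask_def right_mult_one_mat[OF B] del: index_mult_mat)
        (simp add: index_mult_mat(2,3))
  qed
  finally show "conv_mask n B (shift_mask n E) \<alpha> $$ (i,j) = (B (\<alpha> + 1) - B \<alpha> * E) $$ (i,j)"
    using i j by (simp add: conv_mask_def)
qed

section \<open>Right division by a difference operator\<close>

text \<open>
  Division of \<open>C\<close> on the right by the difference operator, with quotient \<open>B\<close> and remainder zero.
  The family \<open>W\<close> of solutions of the difference equation detects the remainder: its initial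
  values are annihilated by no nonzero matrix.
\<close>

lemma right_division:
  assumes E: "E \<in> carrier_mat n n"
    and W: "\<And>w \<alpha>. w \<in> W \<Longrightarrow> w \<alpha> \<in> carrier_vec n"
    and step: "\<And>w \<alpha>. w \<in> W \<Longrightarrow> w (\<alpha> + 1) = cmat E *\<^sub>v w \<alpha>"
    and sep: "\<And>X. \<lbrakk>X \<in> carrier_mat n n; \<And>w. w \<in> W \<Longrightarrow> cmat X *\<^sub>v w 0 = 0\<^sub>v n\<rbrakk> \<Longrightarrow> X = 0\<^sub>m n n"
    and C: "C \<in> masks n"
    and ann: "\<And>w \<alpha>. w \<in> W \<Longrightarrow> conv_vec n C w \<alpha> = 0\<^sub>v n"
  shows "\<exists>B\<in>masks n. \<forall>\<alpha>. B (\<alpha> + 1) = C \<alpha> + B \<alpha> * E"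
proof -
  obtain N where N: "\<And>\<alpha>. \<alpha> < - int N \<or> int N < \<alpha> \<Longrightarrow> C \<alpha> = 0\<^sub>m n n"
    using masks_bounded[OF C] by blast
  note Cc = masks_carrier[OF C]
  define b where "b = rec_nat (0\<^sub>m n n) (\<lambda>k X. C (int k - int N) + X * E)"
  have b0: "b 0 = 0\<^sub>m n n" and bS: "b (Suc k) = C (int k - int N) + b k * E" for k
    by (simp_all add: b_def)
  have bc: "b k \<in> carrier_mat n n" for k
    by (induction k) (use E Cc in \<open>auto simp: b0 bS intro!: add_carrier_mat mult_carrier_mat\<close>)
  \<comment> \<open>Iterating the recursion moves the factor E onto the solution as a shift, which
  turns the partial quotient into a partial sum of the convolution.\<close>
  have b_apply: "(cmat (b k) *\<^sub>v w s) $ i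
      = (\<Sum>j<k. (cmat (C (int j - int N)) *\<^sub>v w (s + int k - 1 - int j)) $ i)"
    if w: "w \<in> W" and i: "i < n" for k s w i
  proof (induction k arbitrary: s)
    case 0
    then show ?case using W[OF w] i by (simp add: b0 cmat_mult_vec_index[of _ n] del: index_mult_mat_vec)
  next
    case (Suc k)
    have "cmat (b (Suc k)) *\<^sub>v w s
        = cmat (C (int k - int N)) *\<^sub>v w s + (cmat (b k) * cmat E) *\<^sub>v w s"
    proof -
      have "cmat (b (Suc k)) = cmat (C (int k - int N)) + cmat (b k) * cmat E"
        unfolding bS cmat_mult[OF bc E, symmetric]
        using Cc[of "int k - int N"] bc[of k] E by (intro eq_matI) auto
      then show ?thesis
        using Cc[of "int k - int N"] bc[of k] E W[OF w, of s]
        by (simp add: add_mult_distrib_mat_vec[of _ n n])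
    qed
    also have "(cmat (b k) * cmat E) *\<^sub>v w s = cmat (b k) *\<^sub>v w (s + 1)"
      unfolding step[OF w] using bc[of k] E W[OF w]
      by (intro assoc_mult_mat_vec[of _ n n _ n]) auto
    finally have "(cmat (b (Suc k)) *\<^sub>v w s) $ i
        = (cmat (C (int k - int N)) *\<^sub>v w s) $ i + (cmat (b k) *\<^sub>v w (s + 1)) $ i"
      using i bc[of k] by (simp del: index_mult_mat_vec)
    then show ?case
      unfolding Suc by (simp add: algebra_simps del: index_mult_mat_vec)
  qed
  \<comment> \<open>After 2N + 1 steps the whole support of C has been consumed, and the partial sum
  is the convolution itself.\<close>
  let ?K = "2 * N + 1"
  have bK: "b ?K = 0\<^sub>m n n"
  proof (rule sep[OF bc])
    fix w assume w: "w \<in> W"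
    show "cmat (b ?K) *\<^sub>v w 0 = 0\<^sub>v n"
    proof (rule eq_vecI)
      fix i assume "i < dim_vec (0\<^sub>v n :: complex vec)"
      then have i: "i < n" by simp
      let ?h = "\<lambda>\<beta>. (cmat (C \<beta>) *\<^sub>v w (int N - \<beta>)) $ i"
      have "(cmat (b ?K) *\<^sub>v w 0) $ i = (\<Sum>j<?K. ?h (int j - int N))"
        unfolding b_apply[OF w i] by (rule sum.cong) (auto simp: algebra_simps)
      also have "\<dots> = sum ?h {- int N..int N}"
        by (rule sum.reindex_bij_witness[of _ "\<lambda>\<beta>. nat (\<beta> + int N)" "\<lambda>j. int j - int N"]) auto
      also have "\<dots> = Sum_any ?h"
      proof (rule Sum_any.expand_superset[symmetric])
        have "?h \<beta> = 0" if "\<beta> \<notin> {- int N..int N}" for \<beta>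
          using N[of \<beta>] that W[OF w] i
          by (auto simp: cmat_mult_vec_index[of _ n] not_le simp del: index_mult_mat_vec)
        then show "{\<beta>. ?h \<beta> \<noteq> 0} \<subseteq> {- int N..int N}" by blast
      qed simp
      also have "\<dots> = conv_vec n C w (int N) $ i"
        using i by (simp add: conv_vec_def)
      also have "\<dots> = 0" using ann[OF w] i by simp
      finally show "(cmat (b ?K) *\<^sub>v w 0) $ i = 0\<^sub>v n $ i" using i by simp
    qed (use bc[of ?K] in simp)
  qed
  have b_large: "b k = 0\<^sub>m n n" if "k \<ge> ?K" for k
    using that
  proof (induction k rule: dec_induct)
    case (step k)
    then show ?case using E N[of "int k - int N"] by (simp add: bS left_mult_zero_mat[OF E])
  qed (rule bK)
  define B where "B \<alpha> = (if \<alpha> < - int N then 0\<^sub>m n n else b (nat (\<alpha> + int N)))" for \<alpha>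
  have "B (\<alpha> + 1) = C \<alpha> + B \<alpha> * E" for \<alpha>
  proof (cases "\<alpha> < - int N")
    case True
    moreover have "\<alpha> + 1 = - int N" if "\<not> \<alpha> + 1 < - int N" using True that by simp
    ultimately show ?thesis using N[of \<alpha>] E b0 by (auto simp: B_def left_mult_zero_mat[OF E])
  next
    case False
    then have "nat (\<alpha> + 1 + int N) = Suc (nat (\<alpha> + int N))" "int (nat (\<alpha> + int N)) - int N = \<alpha>"
      by auto
    moreover have "\<not> \<alpha> + 1 < - int N" using False by simp
    ultimately show ?thesis
      using False bS[of "nat (\<alpha> + int N)"] by (simp only: B_def if_False)
  qed
  moreover have "B \<in> masks n"
  proof (rule masks_if_bounded[of _ _ "- int N" "int N"])
    show "B \<alpha> \<in> carrier_mat n n" for \<alpha> using bc by (simp add: B_def)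
    show "B \<alpha> = 0\<^sub>m n n" if "\<alpha> < - int N \<or> int N < \<alpha>" for \<alpha>
      using that b_large by (auto simp: B_def)
  qed
  ultimately show ?thesis by blast
qed

text \<open>
  The entries of a subdivided sequence in one residue class modulo 2 see only the entries of the
  mask in the same class, on which subdivision is a convolution.
\<close>

lemma polyphase_conv_vec:
  "conv_vec n (\<lambda>\<gamma>. C (2 * \<gamma> + \<rho>)) c \<alpha> = subdiv n C c (2 * \<alpha> + \<rho>)"
proof -
  have bij: "bij (\<lambda>\<beta>. \<alpha> - \<beta> :: int)"
    by (rule bij_betw_byWitness[of _ "\<lambda>\<beta>. \<alpha> - \<beta>"]) auto
  have "2 * \<alpha> + \<rho> - 2 * (\<alpha> - \<beta>) = 2 * \<beta> + \<rho>" for \<beta>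
    by simp
  then have "Sum_any (\<lambda>\<beta>. (cmat (C (2 * \<beta> + \<rho>)) *\<^sub>v c (\<alpha> - \<beta>)) $ i)
      = Sum_any (\<lambda>\<beta>. (cmat (C (2 * \<alpha> + \<rho> - 2 * \<beta>)) *\<^sub>v c \<beta>) $ i)" for i
    by (intro Sum_any.reindex_cong[OF bij, symmetric]) (simp only: o_def)
  then show ?thesis by (simp add: conv_vec_def subdiv_def)
qed

text \<open>
  The recursion for \<open>B\<close> has step 2 here, since in \<open>S\<^sub>B (c(\<cdot> + 1))\<close> a shift of \<open>c\<close> by one shifts
  the mask by two.
\<close>

lemma subdiv_factor:
  assumes E: "E \<in> carrier_mat n n" and B: "B \<in> masks n" and C: "C \<in> masks n"
    and c: "c \<in> vseqs n"
    and rec: "\<And>\<alpha>. B (\<alpha> + 2) = C \<alpha> + B \<alpha> * E"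
  shows "subdiv n C c = subdiv n B (conv_vec n (shift_mask n E) c)"
proof (intro ext eq_vecI)
  fix \<alpha> i assume "i < dim_vec (subdiv n B (conv_vec n (shift_mask n E) c) \<alpha>)"
  then have i: "i < n" by (simp add: subdiv_def)
  have cc: "c \<beta> \<in> carrier_vec n" for \<beta> using c by (simp add: vseqs_def)
  note Bc = masks_carrier[OF B] and Cc = masks_carrier[OF C]
  let ?f1 = "\<lambda>\<beta>. (cmat (B (\<alpha> + 2 - 2 * \<beta>)) *\<^sub>v c \<beta>) $ i"
  let ?f2 = "\<lambda>\<beta>. (cmat (B (\<alpha> - 2 * \<beta>)) *\<^sub>v (cmat E *\<^sub>v c \<beta>)) $ i"
  let ?f3 = "\<lambda>\<beta>. (cmat (C (\<alpha> - 2 * \<beta>)) *\<^sub>v c \<beta>) $ i"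
  let ?g = "\<lambda>\<beta>. (cmat (B (\<alpha> - 2 * \<beta>)) *\<^sub>v (c (\<beta> + 1) - cmat E *\<^sub>v c \<beta>)) $ i"
  have Ec: "cmat E *\<^sub>v c \<beta> \<in> carrier_vec n" for \<beta> using E by simp
  have inj: "inj (\<lambda>\<beta>::int. a - 2 * \<beta>)" for a by (simp add: inj_def)
  have fin2: "finite {\<beta>. ?f2 \<beta> \<noteq> 0}" by (rule finite_vec_summand[OF B inj i Ec])
  have fin3: "finite {\<beta>. ?f3 \<beta> \<noteq> 0}" by (rule finite_vec_summand[OF C inj i cc])
  have fing: "finite {\<beta>. ?g \<beta> \<noteq> 0}"
    by (rule finite_vec_summand[OF B inj i]) (use cc Ec in auto)
  \<comment> \<open>Both sides are compared with the sum of f1: the recursion splits f1 into f3 and f2,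
  and a shift of the summation index turns f1 into g + f2.\<close>
  have "Sum_any ?f3 + Sum_any ?f2 = Sum_any (\<lambda>\<beta>. ?f3 \<beta> + ?f2 \<beta>)"
    by (rule Sum_any.distrib[OF fin3 fin2, symmetric])
  also have "\<dots> = Sum_any ?f1"
  proof (rule Sum_any.cong)
    fix \<beta>
    have "cmat (B (\<alpha> + 2 - 2 * \<beta>)) = cmat (C (\<alpha> - 2 * \<beta>)) + cmat (B (\<alpha> - 2 * \<beta>)) * cmat E"
    proof -
      have "B (\<alpha> + 2 - 2 * \<beta>) = C (\<alpha> - 2 * \<beta>) + B (\<alpha> - 2 * \<beta>) * E"
        using rec[of "\<alpha> - 2 * \<beta>"] by (simp add: algebra_simps)
      then show ?thesis
        unfolding cmat_mult[OF Bc E, symmetric]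
        using Cc[of "\<alpha> - 2 * \<beta>"] Bc[of "\<alpha> - 2 * \<beta>"] E by (intro eq_matI) auto
    qed
    then have "cmat (B (\<alpha> + 2 - 2 * \<beta>)) *\<^sub>v c \<beta>
        = cmat (C (\<alpha> - 2 * \<beta>)) *\<^sub>v c \<beta> + cmat (B (\<alpha> - 2 * \<beta>)) *\<^sub>v (cmat E *\<^sub>v c \<beta>)"
      using Cc[of "\<alpha> - 2 * \<beta>"] Bc[of "\<alpha> - 2 * \<beta>"] E cc[of \<beta>]
      by (simp add: add_mult_distrib_mat_vec[of _ n n] assoc_mult_mat_vec[of _ n n _ n])
    then show "?f3 \<beta> + ?f2 \<beta> = ?f1 \<beta>"
      using i Bc[of "\<alpha> - 2 * \<beta>"] by (simp del: index_mult_mat_vec)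
  qed
  also have "\<dots> = Sum_any (\<lambda>\<beta>. ?g \<beta> + ?f2 \<beta>)"
  proof (rule Sum_any.reindex_cong[of "\<lambda>\<beta>. \<beta> + 1"])
    show "bij (\<lambda>\<beta>. \<beta> + 1 :: int)"
      by (rule bij_betw_byWitness[of _ "\<lambda>\<beta>. \<beta> - 1"]) auto
    have "?f1 (\<beta> + 1) = ?g \<beta> + ?f2 \<beta>" for \<beta>
      using Bc[of "\<alpha> - 2 * \<beta>"] i cc[of "\<beta> + 1"] Ec[of \<beta>]
      by (simp add: mult_minus_distrib_mat_vec[of _ n n] algebra_simps del: index_mult_mat_vec)
    then show "?f1 \<circ> (\<lambda>\<beta>. \<beta> + 1) = (\<lambda>\<beta>. ?g \<beta> + ?f2 \<beta>)" by (simp add: fun_eq_iff)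
  qed
  also have "\<dots> = Sum_any ?g + Sum_any ?f2"
    by (rule Sum_any.distrib[OF fing fin2])
  finally have "Sum_any ?f3 = Sum_any ?g" by simp
  then show "subdiv n C c \<alpha> $ i = subdiv n B (conv_vec n (shift_mask n E) c) \<alpha> $ i"
    using i by (simp add: subdiv_def conv_vec_shift_mask[where c = c, OF E cc] del: index_mult_mat_vec)
qed (simp add: subdiv_def)

text \<open>
  Any space of functions whose derivative vectors obey a first-order recursion with matrix \<open>E\<close>
  and have spanning initial values is minimally annihilated by the corresponding difference
  operator. The spanning condition enters in its dual form, as the absence of a nonzero matrix
  that annihilates all initial values.
\<close>

theorem shift_mask_minimal_annihilator:
  assumes E: "E \<in> carrier_mat (d + 1) (d + 1)"
    and step: "\<And>f \<alpha>. f \<in> V \<Longrightarrow> v_seq d f (\<alpha> + 1) = cmat E *\<^sub>v v_seq d f \<alpha>"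
    and sep: "\<And>X. \<lbrakk>X \<in> carrier_mat (d + 1) (d + 1);
      \<And>f. f \<in> V \<Longrightarrow> cmat X *\<^sub>v v_seq d f 0 = 0\<^sub>v (d + 1)\<rbrakk> \<Longrightarrow> X = 0\<^sub>m (d + 1) (d + 1)"
  shows "minimal_annihilator d V (shift_mask (d + 1) E)"
proof -
  let ?n = "d + 1" and ?W = "v_seq d ` V"
  have vc: "v_seq d f \<alpha> \<in> carrier_vec ?n" for f \<alpha> by (simp add: v_seq_def)
  have divide: "\<exists>B\<in>masks ?n. \<forall>\<alpha>. B (\<alpha> + 1) = C \<alpha> + B \<alpha> * E"
    if "C \<in> masks ?n" "\<And>f \<alpha>. f \<in> V \<Longrightarrow> conv_vec ?n C (v_seq d f) \<alpha> = 0\<^sub>v ?n" for C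
  proof (rule right_division[where W = ?W])
    show "E \<in> carrier_mat ?n ?n" "C \<in> masks ?n" by fact+
  next
    fix w \<alpha> assume "w \<in> ?W"
    then obtain f where f: "f \<in> V" "w = v_seq d f" by blast
    show "w \<alpha> \<in> carrier_vec ?n" unfolding f(2) by (rule vc)
    show "w (\<alpha> + 1) = cmat E *\<^sub>v w \<alpha>" unfolding f(2) by (rule step[OF f(1)])
    show "conv_vec ?n C w \<alpha> = 0\<^sub>v ?n" unfolding f(2) by (rule that(2)[OF f(1)])
  next
    fix X assume "X \<in> carrier_mat ?n ?n" and X: "\<And>w. w \<in> ?W \<Longrightarrow> cmat X *\<^sub>v w 0 = 0\<^sub>v ?n"
    show "X = 0\<^sub>m ?n ?n" by (rule sep) (fact, rule X, rule imageI)
  qed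
  have "conv_vec ?n (shift_mask ?n E) (v_seq d f) = (\<lambda>_. 0\<^sub>v ?n)" if "f \<in> V" for f
  proof
    fix \<alpha>
    show "conv_vec ?n (shift_mask ?n E) (v_seq d f) \<alpha> = 0\<^sub>v ?n"
      unfolding conv_vec_shift_mask[OF E, where c = "v_seq d f", OF vc] step[OF that] using E by (intro minus_cancel_vec) simp
  qed
  moreover have "\<exists>B\<in>masks ?n. \<forall>c\<in>vseqs ?n.
      subdiv ?n C c = subdiv ?n B (conv_vec ?n (shift_mask ?n E) c)"
    if C: "C \<in> masks ?n" and ann: "\<forall>f\<in>V. subdiv ?n C (v_seq d f) = (\<lambda>_. 0\<^sub>v ?n)" for C
  proof -
    have phase: "\<exists>B\<in>masks ?n. \<forall>\<gamma>. B (\<gamma> + 1) = C (2 * \<gamma> + \<rho>) + B \<gamma> * E" for \<rho>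
    proof (rule divide)
      have "{\<gamma>. C (2 * \<gamma> + \<rho>) \<noteq> 0\<^sub>m ?n ?n} = (\<lambda>\<gamma>. 2 * \<gamma> + \<rho>) -` {\<alpha>. C \<alpha> \<noteq> 0\<^sub>m ?n ?n}"
        by auto
      moreover have "finite \<dots>"
        using C by (intro finite_vimageI) (auto simp: masks_def inj_def)
      ultimately show "(\<lambda>\<gamma>. C (2 * \<gamma> + \<rho>)) \<in> masks ?n"
        using masks_carrier[OF C] by (simp add: masks_def)
    next
      fix f \<alpha> assume "f \<in> V"
      then show "conv_vec ?n (\<lambda>\<gamma>. C (2 * \<gamma> + \<rho>)) (v_seq d f) \<alpha> = 0\<^sub>v ?n"
        using ann by (simp add: polyphase_conv_vec)
    qed
    then obtain b where b: "\<And>\<rho>. b \<rho> \<in> masks ?n"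
      "\<And>\<rho> \<gamma>. b \<rho> (\<gamma> + 1) = C (2 * \<gamma> + \<rho>) + b \<rho> \<gamma> * E"
      by metis
    \<comment> \<open>Interleaving the quotients of the even and the odd part turns two recursions with
    step 1 into one recursion with step 2.\<close>
    define B where "B \<alpha> = b (\<alpha> mod 2) (\<alpha> div 2)" for \<alpha> :: int
    have "B \<in> masks ?n"
    proof -
      let ?S = "\<lambda>\<rho>. {\<gamma>. b \<rho> \<gamma> \<noteq> 0\<^sub>m ?n ?n}"
      have "{\<alpha>. B \<alpha> \<noteq> 0\<^sub>m ?n ?n} \<subseteq> (\<Union>\<rho>\<in>{0,1}. (\<lambda>\<gamma>. 2 * \<gamma> + \<rho>) ` ?S \<rho>)"
      proof
        fix \<alpha> assume "\<alpha> \<in> {\<alpha>. B \<alpha> \<noteq> 0\<^sub>m ?n ?n}"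
        then have "\<alpha> div 2 \<in> ?S (\<alpha> mod 2)" by (simp add: B_def)
        moreover have "\<alpha> = 2 * (\<alpha> div 2) + \<alpha> mod 2" "\<alpha> mod 2 \<in> {0,1}" by auto
        ultimately show "\<alpha> \<in> (\<Union>\<rho>\<in>{0,1}. (\<lambda>\<gamma>. 2 * \<gamma> + \<rho>) ` ?S \<rho>)"
          by (intro UN_I[of "\<alpha> mod 2"] image_eqI[of _ _ "\<alpha> div 2"])
      qed
      moreover have "finite (?S \<rho>)" for \<rho> using b(1)[of \<rho>] by (simp add: masks_def)
      ultimately have "finite {\<alpha>. B \<alpha> \<noteq> 0\<^sub>m ?n ?n}" by (auto intro: finite_subset)
      then show ?thesis using masks_carrier[OF b(1)] by (simp add: masks_def B_def)
    qed
    moreover have "B (\<alpha> + 2) = C \<alpha> + B \<alpha> * E" for \<alpha>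
    proof -
      have "(\<alpha> + 2) mod 2 = \<alpha> mod 2" "(\<alpha> + 2) div 2 = \<alpha> div 2 + 1" by auto
      then show ?thesis using b(2)[of "\<alpha> mod 2" "\<alpha> div 2"] by (simp add: B_def)
    qed
    ultimately show ?thesis using subdiv_factor[OF E _ C] by blast
  qed
  moreover have "\<exists>B\<in>masks ?n. C = conv_mask ?n B (shift_mask ?n E)"
    if C: "C \<in> masks ?n" and ann: "\<forall>f\<in>V. conv_vec ?n C (v_seq d f) = (\<lambda>_. 0\<^sub>v ?n)" for C
  proof -
    obtain B where B: "B \<in> masks ?n" "\<And>\<alpha>. B (\<alpha> + 1) = C \<alpha> + B \<alpha> * E"
      using divide[OF C] ann by auto
    have "C \<alpha> = conv_mask ?n B (shift_mask ?n E) \<alpha>" for \<alpha>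
      unfolding conv_mask_shift_mask[where B = B, OF E masks_carrier[OF B(1)]] B(2)
      using masks_carrier[OF C, of \<alpha>] masks_carrier[OF B(1), of \<alpha>] E
      by (intro eq_matI) (auto simp del: index_mult_mat simp: index_mult_mat(2,3))
    with B(1) show ?thesis by blast
  qed
  ultimately show ?thesis
    using shift_mask_in_masks[OF E] by (simp add: minimal_annihilator_def)
qed

section \<open>Masks and their symbols\<close>

lemma symbol_shift_mask:
  assumes E: "E \<in> carrier_mat n n" and z: "z \<noteq> 0"
  shows "symbol n (shift_mask n E) z = inverse z \<cdot>\<^sub>m 1\<^sub>m n - cmat E"
proof (rule eq_matI)
  fix i j assume "i < dim_row (inverse z \<cdot>\<^sub>m 1\<^sub>m n - cmat E)" "j < dim_col (inverse z \<cdot>\<^sub>m 1\<^sub>m n - cmat E)"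
  then have ij: "i < n" "j < n" using E by auto
  let ?g = "\<lambda>\<alpha>. complex_of_real (shift_mask n E \<alpha> $$ (i,j)) * z powi \<alpha>"
  have "Sum_any ?g = sum ?g {-1, 0}"
    by (rule Sum_any.expand_superset) (use ij in \<open>auto simp: shift_mask_def split: if_splits\<close>)
  also have "\<dots> = (inverse z \<cdot>\<^sub>m 1\<^sub>m n - cmat E) $$ (i,j)"
    using ij E by (auto simp: shift_mask_def power_int_minus)
  finally show "symbol n (shift_mask n E) z $$ (i,j) = (inverse z \<cdot>\<^sub>m 1\<^sub>m n - cmat E) $$ (i,j)"
    using ij by (simp add: symbol_def)
qed (use E in \<open>auto simp: symbol_def\<close>)

text \<open>
  After multiplication by a power of \<open>z\<close>, each entry of the difference of the symbols is a
  polynomial that vanishes at all nonzero \<open>z\<close>. This makes a definite description of a mask by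
  its symbol meaningful.
\<close>

lemma symbol_inject:
  assumes A: "A \<in> masks n" and B: "B \<in> masks n"
    and eq: "\<And>z. z \<noteq> 0 \<Longrightarrow> symbol n A z = symbol n B z"
  shows "A = B"
proof (intro ext eq_matI)
  fix \<alpha> i j assume "i < dim_row (B \<alpha>)" "j < dim_col (B \<alpha>)"
  then have ij: "i < n" "j < n" using masks_carrier[OF B, of \<alpha>] by auto
  obtain N1 where N1: "\<And>\<alpha>. \<alpha> < - int N1 \<or> int N1 < \<alpha> \<Longrightarrow> A \<alpha> = 0\<^sub>m n n"
    using masks_bounded[OF A] by blast
  obtain N2 where N2: "\<And>\<alpha>. \<alpha> < - int N2 \<or> int N2 < \<alpha> \<Longrightarrow> B \<alpha> = 0\<^sub>m n n"
    using masks_bounded[OF B] by blast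
  define N where "N = max N1 N2"
  let ?I = "{- int N..int N}"
  have expand: "Sum_any (\<lambda>\<alpha>. complex_of_real (M \<alpha> $$ (i,j)) * z powi \<alpha>)
      = (\<Sum>\<alpha>\<in>?I. complex_of_real (M \<alpha> $$ (i,j)) * z powi \<alpha>)"
    if "\<And>\<alpha>. \<alpha> \<notin> ?I \<Longrightarrow> M \<alpha> = 0\<^sub>m n n" for M :: "int \<Rightarrow> real mat" and z
  proof (rule Sum_any.expand_superset)
    have "complex_of_real (M \<alpha> $$ (i,j)) * z powi \<alpha> = 0" if "\<alpha> \<notin> ?I" for \<alpha>
      using \<open>\<And>\<alpha>. \<alpha> \<notin> ?I \<Longrightarrow> M \<alpha> = 0\<^sub>m n n\<close>[OF that] ij by simp
    then show "{\<alpha>. complex_of_real (M \<alpha> $$ (i,j)) * z powi \<alpha> \<noteq> 0} \<subseteq> ?I" by blast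
  qed simp
  have AI: "A \<alpha> = 0\<^sub>m n n" if "\<alpha> \<notin> ?I" for \<alpha> using N1[of \<alpha>] that by (auto simp: N_def)
  have BI: "B \<alpha> = 0\<^sub>m n n" if "\<alpha> \<notin> ?I" for \<alpha> using N2[of \<alpha>] that by (auto simp: N_def)
  define c where "c k = complex_of_real (A (int k - int N) $$ (i,j) - B (int k - int N) $$ (i,j))" for k
  have root: "(\<Sum>k\<le>2*N. c k * z ^ k) = 0" if z: "z \<noteq> 0" for z
  proof -
    have "(\<Sum>\<alpha>\<in>?I. complex_of_real (A \<alpha> $$ (i,j)) * z powi \<alpha>)
        = symbol n A z $$ (i,j)"
      using ij by (simp add: symbol_def expand[of A, OF AI] del: atLeastAtMost_iff)
    also have "\<dots> = (\<Sum>\<alpha>\<in>?I. complex_of_real (B \<alpha> $$ (i,j)) * z powi \<alpha>)"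
      unfolding eq[OF z] using ij by (simp add: symbol_def expand[of B, OF BI] del: atLeastAtMost_iff)
    finally have "(\<Sum>\<alpha>\<in>?I. complex_of_real (A \<alpha> $$ (i,j)) * z powi \<alpha>)
        = (\<Sum>\<alpha>\<in>?I. complex_of_real (B \<alpha> $$ (i,j)) * z powi \<alpha>)" .
    then have "0 = z powi int N * (\<Sum>\<alpha>\<in>?I. complex_of_real (A \<alpha> $$ (i,j) - B \<alpha> $$ (i,j)) * z powi \<alpha>)"
      by (simp add: algebra_simps sum_subtractf)
    also have "\<dots> = (\<Sum>\<alpha>\<in>?I. complex_of_real (A \<alpha> $$ (i,j) - B \<alpha> $$ (i,j)) * z powi (\<alpha> + int N))"
      using z by (simp add: sum_distrib_left power_int_add mult_ac)
    also have "\<dots> = (\<Sum>k\<le>2*N. c k * z powi int k)"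
      by (rule sum.reindex_bij_witness[of _ "\<lambda>k. int k - int N" "\<lambda>\<alpha>. nat (\<alpha> + int N)"])
        (auto simp: c_def)
    finally show ?thesis by simp
  qed
  have "infinite (UNIV - {0 :: complex})" by (simp add: infinite_UNIV_char_0)
  moreover have "UNIV - {0} \<subseteq> {z. (\<Sum>k\<le>2*N. c k * z ^ k) = 0}" using root by auto
  ultimately have "infinite {z. (\<Sum>k\<le>2*N. c k * z ^ k) = 0}" using finite_subset by blast
  then have c0: "c k = 0" if "k \<le> 2 * N" for k using polyfun_finite_roots[of c "2 * N"] that by blast
  show "A \<alpha> $$ (i,j) = B \<alpha> $$ (i,j)"
  proof (cases "\<alpha> \<in> ?I")
    case True
    then have "c (nat (\<alpha> + int N)) = 0" by (intro c0) auto
    with True show ?thesis by (auto simp: c_def)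
  next
    case False
    then show ?thesis using AI BI by simp
  qed
qed (simp_all add: carrier_matD[OF masks_carrier[OF A]] carrier_matD[OF masks_carrier[OF B]])

lemma sum_lessThan_add: "(\<Sum>j<a + b. f j) = (\<Sum>j<a. f j) + (\<Sum>i<b. f (a + i))"
  for f :: "nat \<Rightarrow> 'a::comm_monoid_add"
  by (induction b) (auto simp: algebra_simps)

section \<open>The propagation matrix\<close>

text \<open>
  This is the matrix \<open>E\<close> with \<open>H\<^sup>*(z) = z\<^sup>-\<^sup>1 I - E\<close>. It advances the vector of derivatives of a
  function in the space from \<open>x\<close> to \<open>x + 1\<close>.
\<close>

definition step_mat :: "nat \<Rightarrow> nat \<Rightarrow> (nat \<Rightarrow> complex) \<Rightarrow> complex mat" where
  "step_mat p r lam = four_block_mat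
     (mat (p + 1) (p + 1) (\<lambda>(k, k'). if k \<le> k' then 1 / fact (k' - k) else 0))
     (- Q_mat p r lam)
     (0\<^sub>m (2 * r) (p + 1))
     (L_mat p r lam * mat_diag (2 * r) (\<lambda>c. exp (mu lam c)) * the (mat_inverse (L_mat p r lam)))"

lemma scalar_minus_four_block_mat:
  fixes w :: "'a::comm_ring_1"
  assumes "A \<in> carrier_mat a a" "B \<in> carrier_mat a b" "D \<in> carrier_mat b b"
  shows "w \<cdot>\<^sub>m 1\<^sub>m (a + b) - four_block_mat A B (0\<^sub>m b a) D
    = four_block_mat (w \<cdot>\<^sub>m 1\<^sub>m a - A) (- B) (0\<^sub>m b a) (w \<cdot>\<^sub>m 1\<^sub>m b - D)"
  using assms by (intro eq_matI) auto

text \<open>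
  Closure under conjugation holds when each \<open>\<lambda>\<^sub>j\<close> is real or imaginary, since conjugation then
  fixes \<open>\<lambda>\<^sub>j\<close> or changes its sign.
\<close>

locale frequencies =
  fixes p r :: nat and lam :: "nat \<Rightarrow> complex"
  assumes mu_nonzero: "c < 2 * r \<Longrightarrow> mu lam c \<noteq> 0"
    and mu_inj: "inj_on (mu lam) {..<2 * r}"
    and mu_cnj: "c < 2 * r \<Longrightarrow> \<exists>c'<2 * r. mu lam c' = cnj (mu lam c)"
begin

text \<open>
  The \<open>x\<^sub>i\<close> are the coefficients of a polynomial which, divided by \<open>t\<^sup>p\<^sup>+\<^sup>1\<close>, has degree less than
  \<open>2r\<close> but \<open>2r\<close> distinct zeros.
\<close>

lemma vanishing_coeffs:
  assumes "\<And>c. c < 2 * r \<Longrightarrow> (\<Sum>i<2*r. x i * mu lam c ^ (p + 1 + i)) = 0" and "i < 2 * r"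
  shows "x i = 0"
proof (rule ccontr)
  assume "x i \<noteq> 0"
  let ?Z = "{z. (\<Sum>i\<le>2*r-1. x i * z ^ i) = 0}"
  from \<open>x i \<noteq> 0\<close> \<open>i < 2 * r\<close> have Z: "finite ?Z" "card ?Z \<le> 2 * r - 1"
    using polyfun_rootbound[of x i "2 * r - 1"] by auto
  have "mu lam ` {..<2*r} \<subseteq> ?Z"
  proof
    fix z assume "z \<in> mu lam ` {..<2*r}"
    then obtain c where c: "c < 2 * r" "z = mu lam c" by auto
    have "z ^ (p + 1) * (\<Sum>i<2*r. x i * z ^ i) = (\<Sum>i<2*r. x i * z ^ (p + 1 + i))"
      by (simp add: sum_distrib_left power_add mult_ac)
    also have "\<dots> = 0" using assms(1) c by simp
    finally have "(\<Sum>i<2*r. x i * z ^ i) = 0" using mu_nonzero c by auto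
    moreover have "{..<2*r} = {..2*r-1}" using c by auto
    ultimately show "z \<in> ?Z" by simp
  qed
  from card_mono[OF Z(1) this] have "card (mu lam ` {..<2*r}) \<le> 2 * r - 1"
    using Z(2) by linarith
  then show False using card_image[OF mu_inj] \<open>i < 2 * r\<close> by simp
qed

lemma L_mat_carrier: "L_mat p r lam \<in> carrier_mat (2 * r) (2 * r)"
  by (simp add: L_mat_def)

text \<open>
  A vector in the kernel of the transpose of \<open>L\<close> is the coefficient vector of a polynomial as in
  \<open>vanishing_coeffs\<close>.
\<close>

lemma L_mat_inverse:
  "the (mat_inverse (L_mat p r lam)) \<in> carrier_mat (2 * r) (2 * r)"
  "L_mat p r lam * the (mat_inverse (L_mat p r lam)) = 1\<^sub>m (2 * r)"
  "the (mat_inverse (L_mat p r lam)) * L_mat p r lam = 1\<^sub>m (2 * r)"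
proof -
  let ?L = "L_mat p r lam"
  have "det ?L \<noteq> 0"
  proof
    assume "det ?L = 0"
    then have "det (transpose_mat ?L) = 0" using det_transpose[OF L_mat_carrier] by simp
    then obtain v where v: "v \<in> carrier_vec (2 * r)" "v \<noteq> 0\<^sub>v (2 * r)"
        "transpose_mat ?L *\<^sub>v v = 0\<^sub>v (2 * r)"
      using det_0_iff_vec_prod_zero_field[of "transpose_mat ?L" "2 * r"] L_mat_carrier by auto
    have "(\<Sum>i<2*r. v $ i * mu lam c ^ (p + 1 + i)) = 0" if "c < 2 * r" for c
    proof -
      have "0 = (transpose_mat ?L *\<^sub>v v) $ c" using v(3) that by simp
      also have "\<dots> = (\<Sum>i<2*r. v $ i * mu lam c ^ (p + 1 + i))"
        using that v(1) by (auto simp: L_mat_def scalar_prod_def atLeast0LessThan intro!: sum.cong)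
      finally show ?thesis by simp
    qed
    then have "v $ i = 0" if "i < 2 * r" for i
      using vanishing_coeffs[of "\<lambda>i. v $ i"] that by blast
    with v(1,2) show False by (auto intro: eq_vecI)
  qed
  then have "?L \<in> Units (ring_mat TYPE(complex) (2 * r) ())"
    by (rule det_non_zero_imp_unit[OF L_mat_carrier])
  then obtain M where "mat_inverse ?L = Some M"
    using mat_inverse(1)[OF L_mat_carrier, where b = "()"] by blast
  with mat_inverse(2)[OF L_mat_carrier this]
  show "the (mat_inverse ?L) \<in> carrier_mat (2 * r) (2 * r)"
    "?L * the (mat_inverse ?L) = 1\<^sub>m (2 * r)" "the (mat_inverse ?L) * ?L = 1\<^sub>m (2 * r)" by auto
qed

lemma all_frequencies: "(\<forall>j<r. \<forall>\<mu>\<in>{lam j, - lam j}. P \<mu>) \<longleftrightarrow> (\<forall>c<2*r. P (mu lam c))"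
proof
  assume "\<forall>c<2*r. P (mu lam c)"
  then have "P (mu lam (2 * j))" "P (mu lam (2 * j + 1))" if "j < r" for j using that by auto
  then show "\<forall>j<r. \<forall>\<mu>\<in>{lam j, - lam j}. P \<mu>" by (simp add: mu_def)
qed (auto simp: mu_def)

text \<open>
  The equations defining \<open>Q\<close> say that \<open>Q L\<close> is a prescribed matrix; so \<open>Q\<close> exists because \<open>L\<close>
  is invertible, and it is unique row by row by \<open>vanishing_coeffs\<close>.
\<close>

lemma Q_mat_spec:
  "Q_mat p r lam \<in> carrier_mat (p + 1) (2 * r)"
  "\<lbrakk>k \<le> p; c < 2 * r\<rbrakk> \<Longrightarrow> (\<Sum>i<2*r. Q_mat p r lam $$ (k,i) * mu lam c ^ (p + 1 + i))
     = (\<Sum>i=0..p-k. mu lam c ^ (k + i) / fact i) - mu lam c ^ k * exp (mu lam c)"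
proof -
  let ?L = "L_mat p r lam" let ?M = "the (mat_inverse ?L)"
  let ?y = "\<lambda>k c. (\<Sum>i=0..p-k. mu lam c ^ (k + i) / fact i) - mu lam c ^ k * exp (mu lam c)"
  let ?P = "\<lambda>Q. Q \<in> carrier_mat (p + 1) (2 * r) \<and>
     (\<forall>k\<le>p. \<forall>c<2*r. (\<Sum>i<2*r. Q $$ (k,i) * mu lam c ^ (p + 1 + i)) = ?y k c)"
  let ?Pdef = "\<lambda>Q. Q \<in> carrier_mat (p + 1) (2 * r) \<and>
     (\<forall>k\<le>p. \<forall>j<r. \<forall>\<mu>\<in>{lam j, - lam j}.
        \<mu> ^ k * exp \<mu> - (\<Sum>i=0..p - k. \<mu> ^ (k + i) / fact i)
          + (\<Sum>m=p + 1..p + 2 * r. \<mu> ^ m * Q $$ (k, m - (p + 1))) = 0)"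
  have reindex: "(\<Sum>m=p + 1..p + 2 * r. \<mu> ^ m * Q $$ (k, m - (p + 1)))
      = (\<Sum>i<2*r. Q $$ (k,i) * \<mu> ^ (p + 1 + i))" for \<mu> :: complex and Q k
    by (rule sum.reindex_bij_witness[of _ "\<lambda>i. p + 1 + i" "\<lambda>m. m - (p + 1)"]) auto
  have "?Pdef Q \<longleftrightarrow> ?P Q" for Q
    unfolding all_frequencies reindex by (simp add: algebra_simps)
  then have P0P: "?Pdef = ?P" by (intro ext)
  have "\<exists>!Q. ?P Q"
  proof (rule ex_ex1I)
    let ?Y = "mat (p + 1) (2 * r) (\<lambda>(k,c). ?y k c)"
    have YM: "?Y * ?M \<in> carrier_mat (p + 1) (2 * r)"
      using L_mat_inverse(1) by (intro mult_carrier_mat) auto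
    have YM_spec: "(\<Sum>i<2*r. (?Y * ?M) $$ (k,i) * mu lam c ^ (p + 1 + i)) = ?y k c"
      if "k \<le> p" "c < 2 * r" for k c
    proof -
      have "(\<Sum>i<2*r. (?Y * ?M) $$ (k,i) * mu lam c ^ (p + 1 + i)) = ((?Y * ?M) * ?L) $$ (k,c)"
        using that YM L_mat_inverse(1)
        by (subst index_mult_mat(1)[of _ "?Y * ?M"])
          (auto simp: scalar_prod_def L_mat_def atLeast0LessThan simp del: index_mult_mat(1) intro!: sum.cong)
      also have "(?Y * ?M) * ?L = ?Y * (?M * ?L)"
        by (rule assoc_mult_mat[OF mat_carrier L_mat_inverse(1) L_mat_carrier])
      also have "\<dots> = ?Y" unfolding L_mat_inverse(3) by (rule right_mult_one_mat[OF mat_carrier])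
      finally show ?thesis using that by simp
    qed
    have "?P (?Y * ?M)"
    proof (intro conjI allI impI)
      show "?Y * ?M \<in> carrier_mat (p + 1) (2 * r)" by (rule YM)
    qed (rule YM_spec)
    then show "\<exists>Q. ?P Q" by (rule exI[of ?P])
  next
    fix Q Q' assume Q: "?P Q" and Q': "?P Q'"
    show "Q = Q'"
    proof (rule eq_matI)
      fix k i assume "k < dim_row Q'" "i < dim_col Q'"
      with Q' have ki: "k \<le> p" "i < 2 * r" by auto
      have "(\<Sum>i<2*r. (Q $$ (k,i) - Q' $$ (k,i)) * mu lam c ^ (p + 1 + i)) = 0" if "c < 2 * r" for c
        using Q Q' ki(1) that by (simp add: left_diff_distrib sum_subtractf)
      from vanishing_coeffs[OF this ki(2)] show "Q $$ (k,i) = Q' $$ (k,i)" by simp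
    qed (use Q Q' in auto)
  qed
  then have "?P (THE Q. ?P Q)" by (rule theI')
  moreover have "Q_mat p r lam = (THE Q. ?P Q)"
    unfolding Q_mat_def by (rule arg_cong[of _ _ The, OF P0P])
  ultimately have "?P (Q_mat p r lam)" by simp
  then show "Q_mat p r lam \<in> carrier_mat (p + 1) (2 * r)"
    "\<lbrakk>k \<le> p; c < 2 * r\<rbrakk> \<Longrightarrow> (\<Sum>i<2*r. Q_mat p r lam $$ (k,i) * mu lam c ^ (p + 1 + i)) = ?y k c"
    by blast+
qed

lemma step_mat_carrier: "step_mat p r lam \<in> carrier_mat (p + 2 * r + 1) (p + 2 * r + 1)"
proof -
  have "step_mat p r lam \<in> carrier_mat ((p + 1) + 2 * r) ((p + 1) + 2 * r)"
    unfolding step_mat_def using Q_mat_spec(1) L_mat_carrier L_mat_inverse(1)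
    by (intro four_block_carrier_mat mult_carrier_mat) auto
  then show ?thesis by simp
qed

lemma R_const_carrier:
  "L_mat p r lam * mat_diag (2 * r) (\<lambda>c. exp (mu lam c)) * the (mat_inverse (L_mat p r lam))
    \<in> carrier_mat (2 * r) (2 * r)"
  by (intro mult_carrier_mat[OF _ L_mat_inverse(1)] mult_carrier_mat[OF L_mat_carrier]) simp

lemma step_mat_left:
  assumes "k < p + 2 * r + 1" "j < p + 1"
  shows "step_mat p r lam $$ (k,j) = (if k \<le> j then 1 / fact (j - k) else 0)"
  using assms Q_mat_spec(1) L_mat_inverse(1) L_mat_carrier by (auto simp: step_mat_def)

lemma step_mat_top_right:
  assumes "k \<le> p" "i < 2 * r"
  shows "step_mat p r lam $$ (k, p + 1 + i) = - Q_mat p r lam $$ (k,i)"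
  using assms Q_mat_spec(1) L_mat_inverse(1) L_mat_carrier by (simp add: step_mat_def)

lemma step_mat_bottom_right:
  assumes "a < 2 * r" "i < 2 * r"
  shows "step_mat p r lam $$ (p + 1 + a, p + 1 + i)
    = (L_mat p r lam * mat_diag (2 * r) (\<lambda>c. exp (mu lam c)) * the (mat_inverse (L_mat p r lam))) $$ (a,i)"
  using assms Q_mat_spec(1) L_mat_inverse(1) L_mat_carrier
  by (simp add: step_mat_def del: index_mult_mat) (simp add: index_mult_mat(2,3))

text \<open>
  The vector \<open>(1, \<mu>, \<dots>, \<mu>\<^sup>d)\<close> of derivatives of \<open>exp(\<mu> x)\<close> at zero is an eigenvector for the
  eigenvalue \<open>exp \<mu>\<close>: in the upper rows by the choice of \<open>Q\<close>, in the lower rows because the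
  columns of \<open>L\<close> diagonalise the lower right block.
\<close>

lemma step_mat_exponential:
  assumes c: "c < 2 * r" and k: "k < p + 2 * r + 1"
  shows "(\<Sum>j<p + 2 * r + 1. step_mat p r lam $$ (k,j) * mu lam c ^ j) = exp (mu lam c) * mu lam c ^ k"
proof -
  let ?L = "L_mat p r lam" let ?M = "the (mat_inverse ?L)" let ?m = "mu lam c"
  let ?D = "mat_diag (2 * r) (\<lambda>c. exp (mu lam c))"
  have split: "(\<Sum>j<p + 2 * r + 1. step_mat p r lam $$ (k,j) * ?m ^ j)
      = (\<Sum>j<p + 1. (if k \<le> j then 1 / fact (j - k) else 0) * ?m ^ j)
        + (\<Sum>i<2 * r. step_mat p r lam $$ (k, p + 1 + i) * ?m ^ (p + 1 + i))"
  proof -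
    have n: "p + 2 * r + 1 = (p + 1) + 2 * r" by simp
    have "(\<Sum>j<p + 1. step_mat p r lam $$ (k,j) * ?m ^ j)
        = (\<Sum>j<p + 1. (if k \<le> j then 1 / fact (j - k) else 0) * ?m ^ j)"
      by (rule sum.cong[OF refl], subst step_mat_left[OF k]) auto
    then show ?thesis unfolding n sum_lessThan_add by simp
  qed
  show ?thesis
  proof (cases "k \<le> p")
    case True
    have "(\<Sum>j<p + 1. (if k \<le> j then 1 / fact (j - k) else 0) * ?m ^ j)
        = (\<Sum>j\<in>{k..p}. ?m ^ j / fact (j - k))"
      by (rule sum.mono_neutral_cong_right) auto
    also have "\<dots> = (\<Sum>i=0..p-k. ?m ^ (k + i) / fact i)"
      by (rule sum.reindex_bij_witness[of _ "\<lambda>i. k + i" "\<lambda>j. j - k"]) (use True in auto)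
    finally have "(\<Sum>j<p + 1. (if k \<le> j then 1 / fact (j - k) else 0) * ?m ^ j)
        = (\<Sum>i=0..p-k. ?m ^ (k + i) / fact i)" .
    moreover have "(\<Sum>i<2 * r. step_mat p r lam $$ (k, p + 1 + i) * ?m ^ (p + 1 + i))
        = - (\<Sum>i<2 * r. Q_mat p r lam $$ (k,i) * ?m ^ (p + 1 + i))"
      unfolding sum_negf[symmetric]
      by (rule sum.cong) (use step_mat_top_right[OF True] in \<open>simp_all del: add_Suc_right add_Suc power_Suc\<close>)
    ultimately show ?thesis
      unfolding split Q_mat_spec(2)[OF True c] by (simp add: mult.commute)
  next
    case False
    then obtain a where a: "k = p + 1 + a" "a < 2 * r"
      using k that[of "k - (p + 1)"] by auto
    have car: "?L * ?D \<in> carrier_mat (2 * r) (2 * r)" using L_mat_carrier by (simp add: mat_diag_def)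
    have "(\<Sum>j<p + 1. (if k \<le> j then 1 / fact (j - k) else 0) * ?m ^ j) = 0"
      using False by (intro sum.neutral) auto
    moreover have "(\<Sum>i<2 * r. step_mat p r lam $$ (k, p + 1 + i) * ?m ^ (p + 1 + i))
        = (\<Sum>i<2 * r. (?L * ?D * ?M) $$ (a,i) * ?L $$ (i,c))"
      by (rule sum.cong) (use c a step_mat_bottom_right[OF a(2)] in
          \<open>auto simp: L_mat_def simp del: index_mult_mat\<close>)
    moreover have "\<dots> = (?L * ?D * ?M * ?L) $$ (a,c)"
      by (rule mult_mat_index[OF mult_carrier_mat[OF car L_mat_inverse(1)] L_mat_carrier a(2) c, symmetric])
    moreover have "?L * ?D * ?M * ?L = ?L * ?D * (?M * ?L)"
      by (rule assoc_mult_mat[OF car L_mat_inverse(1) L_mat_carrier])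
    moreover have "\<dots> = ?L * ?D" unfolding L_mat_inverse(3) by (rule right_mult_one_mat[OF car])
    moreover have "(?L * ?D) $$ (a,c) = exp ?m * ?m ^ k"
      unfolding mat_diag_mult_right[OF L_mat_carrier] using a c by (simp add: L_mat_def)
    ultimately show ?thesis unfolding split by simp
  qed
qed

text \<open>
  A row vector is determined by its first \<open>p + 1\<close> entries and its products with the vectors of
  powers of the frequencies.
\<close>

lemma vanishing_row:
  assumes "\<And>j. j \<le> p \<Longrightarrow> x j = 0"
    and "\<And>c. c < 2 * r \<Longrightarrow> (\<Sum>j<p + 2 * r + 1. x j * mu lam c ^ j) = 0"
    and "j < p + 2 * r + 1"
  shows "x j = 0"
proof (cases "j \<le> p")
  case False
  have "(\<Sum>i<2 * r. x (p + 1 + i) * mu lam c ^ (p + 1 + i)) = 0" if "c < 2 * r" for c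
  proof -
    have "(\<Sum>j<(p + 1) + 2 * r. x j * mu lam c ^ j) = 0"
      using assms(2)[OF that] by (simp add: add_ac)
    moreover have "(\<Sum>j<p + 1. x j * mu lam c ^ j) = 0"
      by (intro sum.neutral) (use assms(1) in auto)
    ultimately show ?thesis unfolding sum_lessThan_add by simp
  qed
  moreover have "j - (p + 1) < 2 * r" using False assms(3) by auto
  ultimately have "x (p + 1 + (j - (p + 1))) = 0" by (rule vanishing_coeffs)
  with False show ?thesis by simp
qed (rule assms(1))

text \<open>
  Conjugating the eigenvector equations permutes them, because the frequencies are closed under
  conjugation, and the first \<open>p + 1\<close> columns are visibly real. By \<open>vanishing_row\<close> these data
  determine the matrix, so it equals its conjugate.
\<close>

lemma step_mat_real:
  assumes k: "k < p + 2 * r + 1" and j: "j < p + 2 * r + 1"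
  shows "of_real (Re (step_mat p r lam $$ (k,j))) = step_mat p r lam $$ (k,j)"
proof -
  let ?S = "step_mat p r lam"
  let ?x = "\<lambda>j. cnj (?S $$ (k,j)) - ?S $$ (k,j)"
  have "?x j = 0"
  proof (rule vanishing_row[of ?x, OF _ _ j])
    show "?x j = 0" if "j \<le> p" for j using step_mat_left[OF k, of j] that by simp
    fix c assume c: "c < 2 * r"
    then obtain c' where c': "c' < 2 * r" "mu lam c' = cnj (mu lam c)" using mu_cnj by blast
    have "(\<Sum>j<p + 2 * r + 1. cnj (?S $$ (k,j)) * mu lam c ^ j)
        = cnj (\<Sum>j<p + 2 * r + 1. ?S $$ (k,j) * mu lam c' ^ j)"
      unfolding cnj_sum by (simp add: c'(2))
    also have "\<dots> = exp (mu lam c) * mu lam c ^ k"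
      unfolding step_mat_exponential[OF c'(1) k]
      by (simp add: c'(2)) (simp add: complex_eq_iff Re_exp Im_exp)
    finally show "(\<Sum>j<p + 2 * r + 1. ?x j * mu lam c ^ j) = 0"
      using step_mat_exponential[OF c k] by (simp only: left_diff_distrib sum_subtractf) simp
  qed
  then show ?thesis by (simp add: complex_eq_iff)
qed

lemma cmat_Re_step_mat: "cmat (map_mat Re (step_mat p r lam)) = step_mat p r lam"
  using step_mat_carrier by (intro eq_matI) (auto simp: step_mat_real)

lemma Re_step_mat_carrier:
  "map_mat Re (step_mat p r lam) \<in> carrier_mat (p + 2 * r + 1) (p + 2 * r + 1)"
  using step_mat_carrier by simp

lemma R_symbol_eq:
  "R_symbol p r lam z = inverse z \<cdot>\<^sub>m 1\<^sub>m (2 * r)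
    - L_mat p r lam * mat_diag (2 * r) (\<lambda>c. exp (mu lam c)) * the (mat_inverse (L_mat p r lam))"
proof -
  let ?L = "L_mat p r lam" let ?M = "the (mat_inverse ?L)"
  let ?D = "mat_diag (2 * r) (\<lambda>c. exp (mu lam c))"
  have car: "?L * ?D \<in> carrier_mat (2 * r) (2 * r)" using L_mat_carrier by (simp add: mat_diag_def)
  have "?L * Delta_symbol r lam z = inverse z \<cdot>\<^sub>m ?L - ?L * ?D"
    unfolding Delta_symbol_def mat_diag_mult_right[OF L_mat_carrier]
    using L_mat_carrier by (intro eq_matI) (auto simp: algebra_simps)
  then have "R_symbol p r lam z = (inverse z \<cdot>\<^sub>m ?L - ?L * ?D) * ?M"
    by (simp add: R_symbol_def)
  also have "\<dots> = (inverse z \<cdot>\<^sub>m ?L) * ?M - ?L * ?D * ?M"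
    by (rule minus_mult_distrib_mat[OF _ car L_mat_inverse(1)]) (simp add: L_mat_carrier)
  also have "(inverse z \<cdot>\<^sub>m ?L) * ?M = inverse z \<cdot>\<^sub>m (?L * ?M)"
    by (rule mult_smult_assoc_mat[OF L_mat_carrier L_mat_inverse(1)])
  finally show ?thesis unfolding L_mat_inverse(2) .
qed

lemma H_symbol_eq:
  "H_symbol p r lam z = inverse z \<cdot>\<^sub>m 1\<^sub>m (p + 2 * r + 1) - step_mat p r lam"
proof -
  have T: "T_symbol p z = inverse z \<cdot>\<^sub>m 1\<^sub>m (p + 1)
      - mat (p + 1) (p + 1) (\<lambda>(k, k'). if k \<le> k' then 1 / fact (k' - k) else 0)"
    by (rule eq_matI) (auto simp: T_symbol_def)
  have Q: "Q_mat p r lam = - (- Q_mat p r lam)"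
    by (rule eq_matI) auto
  have n: "p + 2 * r + 1 = (p + 1) + 2 * r" by simp
  have "- Q_mat p r lam \<in> carrier_mat (p + 1) (2 * r)" using Q_mat_spec(1) by simp
  from scalar_minus_four_block_mat[OF mat_carrier this R_const_carrier]
  show ?thesis
    unfolding n H_symbol_def step_mat_def T R_symbol_eq by (subst Q) (rule sym)
qed

lemma H_mask_eq: "H_mask p r lam = shift_mask (p + 2 * r + 1) (map_mat Re (step_mat p r lam))"
proof -
  let ?n = "p + 2 * r + 1" and ?S = "shift_mask (p + 2 * r + 1) (map_mat Re (step_mat p r lam))"
  have S: "?S \<in> masks ?n" by (rule shift_mask_in_masks[OF Re_step_mat_carrier])
  have sym: "symbol ?n ?S z = H_symbol p r lam z" if "z \<noteq> 0" for z
    unfolding symbol_shift_mask[OF Re_step_mat_carrier that] cmat_Re_step_mat H_symbol_eq ..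
  show ?thesis unfolding H_mask_def
  proof (rule the_equality)
    fix H assume H: "H \<in> masks ?n \<and> (\<forall>z. z \<noteq> 0 \<longrightarrow> symbol ?n H z = H_symbol p r lam z)"
    show "H = ?S" by (rule symbol_inject[of _ ?n]) (use H S sym in auto)
  qed (use S sym in blast)
qed

end

section \<open>Derivatives of exponential polynomials\<close>

lemma nth_deriv_eqI:
  assumes "F 0 = f" "\<And>k x. (F k has_vector_derivative F (Suc k) x) (at x)"
  shows "nth_deriv k f = F k"
proof (induction k)
  case (Suc k)
  have "nth_deriv (Suc k) f = (\<lambda>x. vector_derivative (nth_deriv k f) (at x))"
    by (simp add: nth_deriv_def)
  also have "\<dots> = F (Suc k)" unfolding Suc using vector_derivative_at[OF assms(2)] by (intro ext)
  finally show ?case .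
qed (simp add: nth_deriv_def assms)

lemma power_derivatives:
  fixes m k :: nat and x :: real
  defines "F \<equiv> \<lambda>k x. if k \<le> m then fact m / fact (m - k) * complex_of_real x ^ (m - k) else 0"
  shows "(F k has_vector_derivative F (Suc k) x) (at x)"
proof -
  consider "k < m" | "k = m" | "k > m" by linarith
  then show ?thesis
  proof cases
    case 1
    then obtain l where l: "m = k + Suc l" using less_imp_Suc_add by auto
    have "((\<lambda>z. fact m / fact (Suc l) * z ^ Suc l) has_field_derivative
        fact m / fact (Suc l) * (of_nat (Suc l) * complex_of_real x ^ l)) (at (complex_of_real x))"
    proof (rule DERIV_cmult)
      show "((\<lambda>z. z ^ Suc l) has_field_derivative of_nat (Suc l) * complex_of_real x ^ l)
          (at (complex_of_real x))"
        using DERIV_power[OF DERIV_ident, where n = "Suc l" and x = "complex_of_real x" and s = UNIV] by simp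
    qed
    from has_vector_derivative_real_field[OF this]
    have D: "((\<lambda>x. fact m / fact (Suc l) * complex_of_real x ^ Suc l) has_vector_derivative
        fact m / fact (Suc l) * (of_nat (Suc l) * complex_of_real x ^ l)) (at x)" .
    have m: "k \<le> m" "Suc k \<le> m" "m - k = Suc l" "m - Suc k = l" using l by auto
    have "fact m / fact (Suc l) * (of_nat (Suc l) * complex_of_real x ^ l)
        = fact m / fact l * complex_of_real x ^ l"
      unfolding fact_Suc by (simp add: divide_simps del: of_nat_Suc)
    with D show ?thesis unfolding F_def m using m(1,2) by (simp only: if_True)
  qed (auto simp: F_def)
qed

lemma exp_derivatives:
  "((\<lambda>x. m ^ k * exp (m * complex_of_real x)) has_vector_derivative
     m ^ Suc k * exp (m * complex_of_real x)) (at x)"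
proof -
  have "((\<lambda>z. m ^ k * exp (m * z)) has_field_derivative m ^ k * (exp (m * complex_of_real x) * m))
      (at (complex_of_real x))"
    by (auto intro!: derivative_eq_intros)
  from has_vector_derivative_real_field[OF this] show ?thesis by (simp add: mult_ac)
qed

context frequencies begin

text \<open>
  A sequence of successive derivatives that \<^const>\<open>step_mat\<close> advances by one unit. Recording the
  derivatives as a sequence keeps differentiability at every order available, which makes the
  property linear: \<^const>\<open>nth_deriv\<close> alone respects sums only of differentiable functions.
\<close>

definition propagated_jet :: "(nat \<Rightarrow> real \<Rightarrow> complex) \<Rightarrow> bool" where
  "propagated_jet F \<longleftrightarrow> (\<forall>k x. (F k has_vector_derivative F (Suc k) x) (at x)) \<and>
     (\<forall>k<p + 2 * r + 1. \<forall>x. F k (x + 1) = (\<Sum>j<p + 2 * r + 1. step_mat p r lam $$ (k,j) * F j x))"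

definition propagated :: "(real \<Rightarrow> complex) \<Rightarrow> bool" where
  "propagated f \<longleftrightarrow> (\<exists>F. propagated_jet F \<and> F 0 = f)"

lemma propagated_jetI:
  assumes "\<And>k x. (F k has_vector_derivative F (Suc k) x) (at x)"
    and "\<And>k x. k < p + 2 * r + 1 \<Longrightarrow>
      F k (x + 1) = (\<Sum>j<p + 2 * r + 1. step_mat p r lam $$ (k,j) * F j x)"
  shows "propagated_jet F"
  unfolding propagated_jet_def by (intro conjI allI impI assms)

lemma propagated_jetD:
  assumes "propagated_jet F"
  shows "(F k has_vector_derivative F (Suc k) x) (at x)"
    and "k < p + 2 * r + 1 \<Longrightarrow>
      F k (x + 1) = (\<Sum>j<p + 2 * r + 1. step_mat p r lam $$ (k,j) * F j x)"
  using assms[unfolded propagated_jet_def, THEN conjunct1]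
    assms[unfolded propagated_jet_def, THEN conjunct2] by (iprover, iprover)

text \<open>
  In the first \<open>p + 1\<close> columns the propagation matrix has the coefficients \<open>1/(j - k)!\<close> of the
  Taylor expansion; for a power this expansion is the binomial theorem.
\<close>

lemma propagated_power:
  assumes "m \<le> p"
  shows "propagated (\<lambda>x. complex_of_real x ^ m)"
proof -
  define F where "F k x = (if k \<le> m then fact m / fact (m - k) * complex_of_real x ^ (m - k) else 0)" for k x
  have "F k (x + 1) = (\<Sum>j<p + 2 * r + 1. step_mat p r lam $$ (k,j) * F j x)"
    if k: "k < p + 2 * r + 1" for k x
  proof -
    have "(\<Sum>j<p + 2 * r + 1. step_mat p r lam $$ (k,j) * F j x)
        = (\<Sum>j\<in>{k..m}. fact m / fact (m - j) * complex_of_real x ^ (m - j) / fact (j - k))"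
      by (rule sum.mono_neutral_cong_right)
        (use assms in \<open>auto simp: F_def step_mat_left[OF k]\<close>)
    also have "\<dots> = F k (x + 1)"
    proof (cases "k \<le> m")
      case True
      have "(\<Sum>j\<in>{k..m}. fact m / fact (m - j) * complex_of_real x ^ (m - j) / fact (j - k))
          = (\<Sum>i\<le>m - k. fact m / fact (m - k) * (of_nat ((m - k) choose i) * complex_of_real x ^ i))"
        by (rule sum.reindex_bij_witness[of _ "\<lambda>i. m - i" "\<lambda>j. m - j"])
          (use True in \<open>auto simp: binomial_fact field_simps\<close>)
      also have "\<dots> = fact m / fact (m - k) * (complex_of_real x + 1) ^ (m - k)"
        unfolding sum_distrib_left[symmetric] binomial_ring by simp
      finally show ?thesis using True by (simp add: F_def)
    qed (simp add: F_def)
    finally show ?thesis by simp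
  qed
  moreover have "(F k has_vector_derivative F (Suc k) x) (at x)" for k x
    using power_derivatives[of k m x] by (simp only: F_def[abs_def])
  ultimately have "propagated_jet F" by (intro propagated_jetI)
  moreover have "F 0 = (\<lambda>x. complex_of_real x ^ m)" by (simp add: F_def fun_eq_iff)
  ultimately show ?thesis unfolding propagated_def by blast
qed

lemma propagated_exp:
  assumes "c < 2 * r"
  shows "propagated (\<lambda>x. exp (mu lam c * complex_of_real x))"
proof -
  let ?F = "\<lambda>k x. mu lam c ^ k * exp (mu lam c * complex_of_real x)"
  have "?F k (x + 1) = (\<Sum>j<p + 2 * r + 1. step_mat p r lam $$ (k,j) * ?F j x)"
    if k: "k < p + 2 * r + 1" for k x
  proof -
    have "(\<Sum>j<p + 2 * r + 1. step_mat p r lam $$ (k,j) * ?F j x)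
        = (\<Sum>j<p + 2 * r + 1. step_mat p r lam $$ (k,j) * mu lam c ^ j) * exp (mu lam c * complex_of_real x)"
      unfolding sum_distrib_right by (simp only: mult_ac)
    also have "\<dots> = ?F k (x + 1)"
      unfolding step_mat_exponential[OF assms k] by (simp add: exp_add distrib_left)
    finally show ?thesis by simp
  qed
  then have "propagated_jet ?F" by (intro propagated_jetI exp_derivatives)
  then show ?thesis unfolding propagated_def by (intro exI[of _ ?F]) simp
qed

lemma subspace_propagated: "cfun.subspace {f. propagated f}"
proof (rule cfun.subspaceI)
  have "propagated_jet (\<lambda>k x. 0)" by (intro propagated_jetI) auto
  then show "0 \<in> {f. propagated f}"
    unfolding propagated_def by (auto intro!: exI[of _ "\<lambda>k x. 0"])
next
  fix f g assume "f \<in> {f. propagated f}" "g \<in> {f. propagated f}"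
  then obtain F G where F: "propagated_jet F" "F 0 = f" and G: "propagated_jet G" "G 0 = g"
    unfolding propagated_def by blast
  have "propagated_jet (\<lambda>k x. F k x + G k x)"
  proof (rule propagated_jetI)
    show "((\<lambda>x. F k x + G k x) has_vector_derivative F (Suc k) x + G (Suc k) x) (at x)" for k x
      by (intro has_vector_derivative_add propagated_jetD(1) F(1) G(1))
    show "F k (x + 1) + G k (x + 1)
        = (\<Sum>j<p + 2 * r + 1. step_mat p r lam $$ (k,j) * (F j x + G j x))"
      if "k < p + 2 * r + 1" for k x
      unfolding propagated_jetD(2)[OF F(1) that] propagated_jetD(2)[OF G(1) that]
        distrib_left sum.distrib ..
  qed
  moreover have "(\<lambda>x. F 0 x + G 0 x) = f + g" by (simp add: F(2) G(2) plus_fun_def)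
  ultimately show "f + g \<in> {f. propagated f}" unfolding propagated_def by blast
next
  fix a f assume "f \<in> {f. propagated f}"
  then obtain F where F: "propagated_jet F" "F 0 = f" unfolding propagated_def by blast
  have "propagated_jet (\<lambda>k x. a * F k x)"
  proof (rule propagated_jetI)
    show "((\<lambda>x. a * F k x) has_vector_derivative a * F (Suc k) x) (at x)" for k x
      by (intro has_vector_derivative_mult_right propagated_jetD(1) F(1))
    show "a * F k (x + 1) = (\<Sum>j<p + 2 * r + 1. step_mat p r lam $$ (k,j) * (a * F j x))"
      if "k < p + 2 * r + 1" for k x
      unfolding propagated_jetD(2)[OF F(1) that] sum_distrib_left by (simp only: mult_ac)
  qed
  then show "(\<lambda>x. a * f x) \<in> {f. propagated f}" unfolding propagated_def F(2)[symmetric] by blast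
qed

lemma generators_in_V_space:
  "m \<le> p \<Longrightarrow> (\<lambda>x. complex_of_real x ^ m) \<in> V_space p r lam"
  "c < 2 * r \<Longrightarrow> (\<lambda>x. exp (mu lam c * complex_of_real x)) \<in> V_space p r lam"
proof -
  show "m \<le> p \<Longrightarrow> (\<lambda>x. complex_of_real x ^ m) \<in> V_space p r lam"
    unfolding V_space_def by (intro cfun.span_base) blast
  assume "c < 2 * r"
  then have "c div 2 < r" "mu lam c \<in> {lam (c div 2), - lam (c div 2)}" by (auto simp: mu_def)
  then show "(\<lambda>x. exp (mu lam c * complex_of_real x)) \<in> V_space p r lam"
    unfolding V_space_def by (intro cfun.span_base) blast
qed

lemma V_space_propagated:
  assumes "f \<in> V_space p r lam"
  shows "propagated f"
  using assms unfolding V_space_def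
proof (induction rule: cfun.span_induct)
  case base
  then show ?case by (rule subspace_propagated)
next
  case (step f)
  then consider (power) m where "m \<le> p" "f = (\<lambda>x. complex_of_real x ^ m)"
    | (exponential) \<mu> j where "j < r" "\<mu> \<in> {lam j, - lam j}" "f = (\<lambda>x. exp (\<mu> * complex_of_real x))"
    by blast
  then show ?case
  proof cases
    case power
    then show ?thesis using propagated_power by simp
  next
    case exponential
    have "\<forall>j<r. \<forall>\<mu>\<in>{lam j, - lam j}. propagated (\<lambda>x. exp (\<mu> * complex_of_real x))"
      unfolding all_frequencies using propagated_exp by blast
    with exponential(1,2) show ?thesis unfolding exponential(3) by blast
  qed
qed

lemma v_seq_step:
  assumes "f \<in> V_space p r lam"
  shows "v_seq (p + 2 * r) f (\<alpha> + 1) = step_mat p r lam *\<^sub>v v_seq (p + 2 * r) f \<alpha>"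
proof -
  obtain F where F: "propagated_jet F" "F 0 = f"
    using V_space_propagated[OF assms] unfolding propagated_def by blast
  have D: "nth_deriv k f = F k" for k by (rule nth_deriv_eqI[where F = F, OF F(2) propagated_jetD(1)[OF F(1)]])
  show ?thesis
  proof (rule eq_vecI)
    fix k assume "k < dim_vec (step_mat p r lam *\<^sub>v v_seq (p + 2 * r) f \<alpha>)"
    then have k: "k < p + 2 * r + 1" using step_mat_carrier by simp
    then have "(step_mat p r lam *\<^sub>v v_seq (p + 2 * r) f \<alpha>) $ k
        = (\<Sum>j<p + 2 * r + 1. step_mat p r lam $$ (k,j) * F j (real_of_int \<alpha>))"
      using step_mat_carrier
      by (auto simp: scalar_prod_def v_seq_def D atLeast0LessThan simp del: sum.lessThan_Suc intro!: sum.cong)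
    with k show "v_seq (p + 2 * r) f (\<alpha> + 1) $ k = (step_mat p r lam *\<^sub>v v_seq (p + 2 * r) f \<alpha>) $ k"
      using propagated_jetD(2)[OF F(1) k, of "real_of_int \<alpha>"] by (simp add: v_seq_def D)
  qed (use step_mat_carrier in \<open>simp add: v_seq_def\<close>)
qed

text \<open>
  The monomials have multiples of the first \<open>p + 1\<close> unit vectors as initial values and the
  exponentials have the vectors of powers of the frequencies, so each row of an annihilating
  matrix vanishes by \<open>vanishing_row\<close>.
\<close>

lemma v_seq_separates:
  assumes X: "X \<in> carrier_mat (p + 2 * r + 1) (p + 2 * r + 1)"
    and ann: "\<And>f. f \<in> V_space p r lam \<Longrightarrow> cmat X *\<^sub>v v_seq (p + 2 * r) f 0 = 0\<^sub>v (p + 2 * r + 1)"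
  shows "X = 0\<^sub>m (p + 2 * r + 1) (p + 2 * r + 1)"
proof (rule eq_matI)
  let ?n = "p + 2 * r + 1"
  fix k j assume "k < dim_row (0\<^sub>m ?n ?n :: real mat)" "j < dim_col (0\<^sub>m ?n ?n :: real mat)"
  then have k: "k < ?n" and j: "j < ?n" by auto
  let ?x = "\<lambda>j. complex_of_real (X $$ (k,j))"
  have row: "(\<Sum>j<?n. ?x j * F j 0) = 0"
    if "f \<in> V_space p r lam" "F 0 = f" "\<And>k x. (F k has_vector_derivative F (Suc k) x) (at x)" for f F
  proof -
    have D: "nth_deriv j f = F j" for j by (rule nth_deriv_eqI[where F = F, OF that(2,3)])
    have "v_seq (p + 2 * r) f 0 \<in> carrier_vec ?n" by (simp add: v_seq_def)
    from cmat_mult_vec_index[OF X this k]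
    have "(cmat X *\<^sub>v v_seq (p + 2 * r) f 0) $ k = (\<Sum>j<?n. ?x j * v_seq (p + 2 * r) f 0 $ j)" .
    also have "\<dots> = (\<Sum>j<?n. ?x j * F j 0)"
      by (rule sum.cong) (auto simp: v_seq_def D)
    finally have "(\<Sum>j<?n. ?x j * F j 0) = (cmat X *\<^sub>v v_seq (p + 2 * r) f 0) $ k" by (rule sym)
    also have "\<dots> = 0" using ann[OF that(1)] k by simp
    finally show ?thesis .
  qed
  have "?x j = 0"
  proof (rule vanishing_row[of ?x, OF _ _ j])
    show "?x m = 0" if "m \<le> p" for m
    proof -
      let ?F = "\<lambda>k x. if k \<le> m then fact m / fact (m - k) * complex_of_real x ^ (m - k) else 0"
      have "(\<Sum>j<?n. ?x j * ?F j 0) = (\<Sum>j<?n. if j = m then ?x j * fact m else 0)"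
        by (rule sum.cong) auto
      also have "\<dots> = ?x m * fact m" using that by simp
      finally have "(\<Sum>j<?n. ?x j * ?F j 0) = ?x m * fact m" .
      moreover have "(\<Sum>j<?n. ?x j * ?F j 0) = 0"
        by (rule row[where F = ?F, OF generators_in_V_space(1)[OF that] _ power_derivatives]) (simp add: fun_eq_iff)
      ultimately show ?thesis by simp
    qed
    show "(\<Sum>j<?n. ?x j * mu lam c ^ j) = 0" if "c < 2 * r" for c
      using row[where F = "\<lambda>k x. mu lam c ^ k * exp (mu lam c * complex_of_real x)",
          OF generators_in_V_space(2)[OF that] _ exp_derivatives] by simp
  qed
  with k j show "X $$ (k,j) = 0\<^sub>m ?n ?n $$ (k,j)" by simp
qed (use X in auto)

theorem H_mask_minimal_annihilator:
  "minimal_annihilator (p + 2 * r) (V_space p r lam) (H_mask p r lam)"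
  unfolding H_mask_eq
  by (rule shift_mask_minimal_annihilator)
    (use Re_step_mat_carrier v_seq_step v_seq_separates in \<open>simp_all only: cmat_Re_step_mat\<close>)

end

theorem corollary21:
  fixes p r d :: nat and lam :: "nat \<Rightarrow> complex"
  assumes "r \<ge> 1"
    and "d = p + 2 * r"
    and "\<And>j. j < r \<Longrightarrow> lam j \<in> \<real> \<union> {\<i> * complex_of_real t | t. True}"
    and "\<And>j. j < r \<Longrightarrow> lam j \<noteq> 0"
    and "\<And>i j. i < r \<Longrightarrow> j < r \<Longrightarrow> i \<noteq> j \<Longrightarrow> lam i \<noteq> lam j \<and> lam i \<noteq> - lam j"
  shows "minimal_annihilator d (V_space p r lam) (H_mask p r lam)"
proof -
  interpret frequencies p r lam
  proof
    fix c assume c: "c < 2 * r"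
    then have h: "c div 2 < r" by simp
    show "mu lam c \<noteq> 0" using assms(4)[OF h] by (simp add: mu_def)
    show "\<exists>c'<2 * r. mu lam c' = cnj (mu lam c)"
    proof (cases "lam (c div 2) \<in> \<real>")
      case True
      then have "mu lam c = cnj (mu lam c)" by (simp add: mu_def Reals_cnj_iff)
      with c show ?thesis by metis
    next
      case False
      then have "cnj (lam (c div 2)) = - lam (c div 2)" using assms(3)[OF h] by auto
      then have cnj: "cnj (mu lam c) = - mu lam c" by (simp add: mu_def)
      \<comment> \<open>Conjugation exchanges the two members of the pair with indices 2j and 2j + 1.\<close>
      show ?thesis
      proof (cases "even c")
        case True
        with h have "c + 1 < 2 * r" "mu lam (c + 1) = - mu lam c" by (auto simp: mu_def)
        with cnj show ?thesis by metis
      next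
        case False
        then have "c - 1 < 2 * r" "mu lam (c - 1) = - mu lam c" using c by (auto simp: mu_def elim!: oddE)
        with cnj show ?thesis by metis
      qed
    qed
  next
    show "inj_on (mu lam) {..<2 * r}"
    proof (rule inj_onI)
      fix a b assume ab: "a \<in> {..<2 * r}" "b \<in> {..<2 * r}" "mu lam a = mu lam b"
      then have h: "a div 2 < r" "b div 2 < r" by auto
      have eq: "a div 2 = b div 2"
      proof (rule ccontr)
        assume "a div 2 \<noteq> b div 2"
        from assms(5)[OF h this] ab(3) show False
          by (auto simp: mu_def minus_equation_iff split: if_splits)
      qed
      have "even a \<longleftrightarrow> even b"
        using ab(3) assms(4)[OF h(2)] by (auto simp: mu_def eq split: if_splits)
      with eq show "a = b" by (metis dvd_mult_div_cancel odd_two_times_div_two_succ)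
    qed
  qed
  show ?thesis unfolding assms(2) by (rule H_mask_minimal_annihilator)
qed

end
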